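(* Let $M\ge 2$, let $\Sigma$ be a known positive definite nondiagonal $M\times M$ matrix, and let $\mathbf{X}\sim N_M(\boldsymbol\mu,\Sigma)$ with $\boldsymbol\mu\in\mathbb{R}^M$ unknown. Consider the two-sided multiple testing problem $H_i:\mu_i=0$ vs. $K_i:\mu_i\neq 0$, $i=1,\ldots,M$. Let $C_1>C_2>\cdots>C_M>0$ be any constants. Then the maximum residual down (MRD) procedure with critical constants $C_1,\ldots,C_M$ is admissible; that is, for every $i\in\{1,\ldots,M\}$ the individual test of $H_i$ vs. $K_i$ induced by the MRD procedure is admissible.
   Context: Notation: $\Sigma=(\sigma_{ij})$. For distinct indices $i_1,\ldots,i_{m-1}$ in $\{1,\ldots,M\}$ ($1\le m\le M$), $\mathbf{x}^{(i_1,\ldots,i_{m-1})}$ is the vector $\mathbf{x}$ with the coordinates $i_1,\ldots,i_{m-1}$ deleted, and $\Sigma_{(i_1,\ldots,i_{m-1})}$ is the covariance matrix of $\mathbf{X}^{(i_1,\ldots,i_{m-1})}$ (delete those rows and columns from $\Sigma$). For $j\notin\{i_1,\ldots,i_{m-1}\}$, $\boldsymbol\sigma_{(j)}^{(i_1,\ldots,i_{m-1})}$ is the $(M-m)\times 1$ vector of covariances between $X_j$ and all variables other than $X_{i_1},\ldots,X_{i_{m-1}},X_j$, and $$\sigma_{(j\cdot i_1,\ldots,i_{m-1})}=\sigma_{jj}-\boldsymbol\sigma_{(j)}^{(i_1,\ldots,i_{m-1})\prime}\,\Sigma^{-1}_{(i_1,\ldots,i_{m-1},j)}\,\boldsymbol\sigma_{(j)}^{(i_1,\ldots,i_{m-1})}$$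 is the conditional variance of $X_j$ given all variables other than $X_{i_1},\ldots,X_{i_{m-1}},X_j$ (equal to $\sigma_{jj}$ when $m=M$). Define $$U_{mj}^{(i_1,\ldots,i_{m-1})}(\mathbf{x})=\Big(x_j-\boldsymbol\sigma_{(j)}^{(i_1,\ldots,i_{m-1})\prime}\,\Sigma^{-1}_{(i_1,\ldots,i_{m-1},j)}\,\mathbf{x}^{(i_1,\ldots,i_{m-1},j)}\Big)\Big/\sigma_{(j\cdot i_1,\ldots,i_{m-1})}^{1/2},$$ where the subtracted term is absent when $m=M$. MRD procedure (two-sided): at stage $m=1,2,\ldots,M$, with $H_{j_1},\ldots,H_{j_{m-1}}$ already rejected, let $j_m$ be the index maximizing $|U_{mj}^{(j_1,\ldots,j_{m-1})}(\mathbf{x})|$ over $j\in\{1,\ldots,M\}\setminus\{j_1,\ldots,j_{m-1}\}$ (ties, which have probability zero, broken by smallest index). If this maximum is $<C_m$, stop and accept all hypotheses not yet rejected. Otherwise reject $H_{j_m}$ and continue to stage $m+1$ (if $m=M$, stop). The induced individual test of $H_i$ is the function equal to $1$ at $\mathbf{x}$ if the procedure rejects $H_i$ when $\mathbf{X}=\mathbf{x}$ is observed, and $0$ otherwise. Admissibility of a test $\phi$ of $H_i$ vs. $K_i$: there is no test $\phi^*:\mathbb{R}^M\to[0,1]$ such that $E_{\boldsymbol\mu}\phi^*(\mathbf{X})\le E_{\boldsymbol\mu}\phi(\mathbf{X})$ for all $\boldsymbol\mu\in\mathbb{R}^M$ with $\mu_i=0$ and $E_{\boldsymbol\mu}\phi^*(\mathbf{X})\ge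 E_{\boldsymbol\mu}\phi(\mathbf{X})$ for all $\boldsymbol\mu\in\mathbb{R}^M$ with $\mu_i\ne 0$, with strict inequality for at least one $\boldsymbol\mu$. *)

theory Defs
  imports "HOL-Probability.Probability"
begin

(* The index set {1,...,M} is a finite linearly ordered type 'n, so M is CARD('n) and the
   order serves to break ties by smallest index. *)

section \<open>Multivariate normal distribution and admissibility\<close>

definition pos_def :: "real^'n^'n \<Rightarrow> bool" where
  "pos_def A \<longleftrightarrow> transpose A = A \<and> (\<forall>x. x \<noteq> 0 \<longrightarrow> 0 < x \<bullet> (A *v x))"

definition mvnormal_density :: "real^'n \<Rightarrow> real^'n^'n \<Rightarrow> real^'n \<Rightarrow> real" where
  "mvnormal_density \<mu> S x =
     exp (- ((x - \<mu>) \<bullet> (matrix_inv S *v (x - \<mu>))) / 2) / sqrt ((2 * pi) ^ CARD('n) * det S)"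

definition mvnormal :: "real^'n \<Rightarrow> real^'n^'n \<Rightarrow> (real^'n) measure" where
  "mvnormal \<mu> S = density lborel (\<lambda>x. ennreal (mvnormal_density \<mu> S x))"

definition is_test :: "(real^'n \<Rightarrow> real) \<Rightarrow> bool" where
  "is_test \<phi> \<longleftrightarrow> \<phi> \<in> borel_measurable borel \<and> (\<forall>x. 0 \<le> \<phi> x \<and> \<phi> x \<le> 1)"

definition power_fun :: "real^'n^'n \<Rightarrow> (real^'n \<Rightarrow> real) \<Rightarrow> real^'n \<Rightarrow> real" where
  "power_fun S \<phi> \<mu> = (LINT x|mvnormal \<mu> S. \<phi> x)"

definition better_test ::
  "real^'n^'n \<Rightarrow> 'n \<Rightarrow> (real^'n \<Rightarrow> real) \<Rightarrow> (real^'n \<Rightarrow> real) \<Rightarrow> bool" where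
  "better_test S i \<psi> \<phi> \<longleftrightarrow>
     (\<forall>\<mu>. \<mu> $ i = 0 \<longrightarrow> power_fun S \<psi> \<mu> \<le> power_fun S \<phi> \<mu>) \<and>
     (\<forall>\<mu>. \<mu> $ i \<noteq> 0 \<longrightarrow> power_fun S \<psi> \<mu> \<ge> power_fun S \<phi> \<mu>) \<and>
     (\<exists>\<mu>. (\<mu> $ i = 0 \<and> power_fun S \<psi> \<mu> < power_fun S \<phi> \<mu>) \<or>
          (\<mu> $ i \<noteq> 0 \<and> power_fun S \<psi> \<mu> > power_fun S \<phi> \<mu>))"

definition admissible_test :: "real^'n^'n \<Rightarrow> 'n \<Rightarrow> (real^'n \<Rightarrow> real) \<Rightarrow> bool" where
  "admissible_test S i \<phi> \<longleftrightarrow>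
     is_test \<phi> \<and> \<not> (\<exists>\<psi>. is_test \<psi> \<and> better_test S i \<psi> \<phi>)"

section \<open>Deletion of coordinates\<close>

(* A vector or matrix with the coordinates in D deleted is represented by putting zeros at the
   deleted positions. This changes neither matrix products nor inner products of the smaller
   objects, whose identity matrix becomes del_mat D (mat 1). *)

definition del_vec :: "'n set \<Rightarrow> real^'n \<Rightarrow> real^'n" where
  "del_vec D x = (\<chi> i. if i \<in> D then 0 else x $ i)"

definition del_mat :: "'n set \<Rightarrow> real^'n^'n \<Rightarrow> real^'n^'n" where
  "del_mat D A = (\<chi> i j. if i \<in> D \<or> j \<in> D then 0 else A $ i $ j)"

(* B is the inverse of the matrix obtained from A by deleting the rows and columns in D. *)
definition is_del_inv :: "'n set \<Rightarrow> real^'n^'n \<Rightarrow> real^'n^'n \<Rightarrow> bool" where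
  "is_del_inv D A B \<longleftrightarrow>
     del_mat D B = B \<and>
     del_mat D A ** B = del_mat D (mat 1) \<and>
     B ** del_mat D A = del_mat D (mat 1)"

definition del_inv :: "'n set \<Rightarrow> real^'n^'n \<Rightarrow> real^'n^'n" where
  "del_inv D A = (THE B. is_del_inv D A B)"

lemma del_mat_mult_one:
  assumes "del_mat D B = B"
  shows "B ** del_mat D (mat 1) = B" "del_mat D (mat 1) ** B = B"
proof -
  have z: "B $ i $ j = 0" if "i \<in> D \<or> j \<in> D" for i j
    using that by (subst assms[symmetric]) (auto simp: del_mat_def)
  have "(\<Sum>k\<in>UNIV. B $ i $ k * del_mat D (mat 1) $ k $ j) =
        (\<Sum>k\<in>UNIV. if k = j then B $ i $ j else 0)" for i j
    by (rule sum.cong) (auto simp: del_mat_def mat_def z)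
  then show "B ** del_mat D (mat 1) = B"
    by (simp add: matrix_matrix_mult_def vec_eq_iff)
  have "(\<Sum>k\<in>UNIV. del_mat D (mat 1) $ i $ k * B $ k $ j) =
        (\<Sum>k\<in>UNIV. if k = i then B $ i $ j else 0)" for i j
    by (rule sum.cong) (auto simp: del_mat_def mat_def z)
  then show "del_mat D (mat 1) ** B = B"
    by (simp add: matrix_matrix_mult_def vec_eq_iff)
qed

lemma is_del_inv_unique:
  assumes "is_del_inv D A B" "is_del_inv D A B'"
  shows "B = B'"
proof -
  have "B = B ** (del_mat D A ** B')"
    using assms by (metis is_del_inv_def del_mat_mult_one(1))
  also have "\<dots> = (B ** del_mat D A) ** B'"
    by (rule matrix_mul_assoc)
  also have "\<dots> = B'"
    using assms by (metis is_del_inv_def del_mat_mult_one(2))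
  finally show ?thesis .
qed

lemma is_del_inv_del_inv:
  assumes "pos_def A"
  shows "is_del_inv D A (del_inv D A)"
proof -
  define P where "P = (\<chi> i j. if i \<in> D \<or> j \<in> D then mat 1 $ i $ j else A $ i $ j)"
  have inj: "x = 0" if "P *v x = 0" for x
  proof -
    have row: "(\<Sum>j\<in>UNIV. P $ i $ j * x $ j) = 0" for i
      using that by (simp add: vec_eq_iff matrix_vector_mult_def)
    have xD: "x $ i = 0" if "i \<in> D" for i
    proof -
      have "(\<Sum>j\<in>UNIV. P $ i $ j * x $ j) = (\<Sum>j\<in>UNIV. if j = i then x $ i else 0)"
        using that by (intro sum.cong) (auto simp: P_def mat_def)
      then show ?thesis using row[of i] by simp
    qed
    have "x $ i * (A *v x) $ i = 0" for i
    proof (cases "i \<in> D")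
      case False
      have "(A *v x) $ i = (\<Sum>j\<in>UNIV. P $ i $ j * x $ j)"
        unfolding matrix_vector_mult_def vec_lambda_beta
        using False by (intro sum.cong) (auto simp: P_def xD)
      then show ?thesis using row[of i] by simp
    qed (simp add: xD)
    then have "x \<bullet> (A *v x) = 0"
      unfolding inner_vec_def inner_real_def by (intro sum.neutral) blast
    then show ?thesis using assms unfolding pos_def_def by force
  qed
  then have "invertible P"
    using matrix_left_invertible_ker[of P] invertible_left_inverse[of P] by blast
  then have PQ: "P ** matrix_inv P = mat 1" and QP: "matrix_inv P ** P = mat 1"
    using someI_ex[of "\<lambda>Q. P ** Q = mat 1 \<and> Q ** P = mat 1"]
    unfolding invertible_def matrix_inv_def by auto
  define B where "B = del_mat D (matrix_inv P)"
  have BB: "del_mat D B = B"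
    by (simp add: B_def del_mat_def vec_eq_iff)
  have AB: "del_mat D A ** B = del_mat D (mat 1)"
    unfolding vec_eq_iff
  proof (intro allI)
    fix i j
    show "(del_mat D A ** B) $ i $ j = del_mat D (mat 1) $ i $ j"
    proof (cases "i \<in> D \<or> j \<in> D")
      case True
      then show ?thesis by (auto simp: matrix_matrix_mult_def del_mat_def B_def)
    next
      case False
      then have "(del_mat D A ** B) $ i $ j = (P ** matrix_inv P) $ i $ j"
        unfolding matrix_matrix_mult_def vec_lambda_beta
        by (intro sum.cong) (auto simp: del_mat_def B_def P_def mat_def)
      then show ?thesis using False by (simp add: PQ del_mat_def)
    qed
  qed
  have BA: "B ** del_mat D A = del_mat D (mat 1)"
    unfolding vec_eq_iff
  proof (intro allI)
    fix i j
    show "(B ** del_mat D A) $ i $ j = del_mat D (mat 1) $ i $ j"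
    proof (cases "i \<in> D \<or> j \<in> D")
      case True
      then show ?thesis by (auto simp: matrix_matrix_mult_def del_mat_def B_def)
    next
      case False
      then have "(B ** del_mat D A) $ i $ j = (matrix_inv P ** P) $ i $ j"
        unfolding matrix_matrix_mult_def vec_lambda_beta
        by (intro sum.cong) (auto simp: del_mat_def B_def P_def mat_def)
      then show ?thesis using False by (simp add: QP del_mat_def)
    qed
  qed
  have "is_del_inv D A B"
    using BB AB BA by (simp add: is_del_inv_def)
  then show ?thesis
    unfolding del_inv_def by (rule theI) (blast intro: is_del_inv_unique[of D A] \<open>is_del_inv D A B\<close>)
qed

section \<open>The two-sided maximum residual down procedure\<close>

(* In the following, R is the set {i_1,...,i_(m-1)} of indices removed so far, and j is an
   index outside R; none of the quantities depends on the order of the removed indices. *)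

definition cov_vec :: "real^'n^'n \<Rightarrow> 'n set \<Rightarrow> 'n \<Rightarrow> real^'n" where
  "cov_vec S R j = del_vec (insert j R) (column j S)"

definition cond_var :: "real^'n^'n \<Rightarrow> 'n set \<Rightarrow> 'n \<Rightarrow> real" where
  "cond_var S R j =
     S $ j $ j - cov_vec S R j \<bullet> (del_inv (insert j R) S *v cov_vec S R j)"

definition mrd_residual :: "real^'n^'n \<Rightarrow> 'n set \<Rightarrow> 'n \<Rightarrow> real^'n \<Rightarrow> real" where
  "mrd_residual S R j x =
     (x $ j - cov_vec S R j \<bullet> (del_inv (insert j R) S *v del_vec (insert j R) x))
       / sqrt (cond_var S R j)"

definition mrd_index ::
  "((real, 'n::{finite,linorder}) vec, 'n) vec \<Rightarrow> (real, 'n) vec \<Rightarrow> 'n set \<Rightarrow> 'n" where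
  "mrd_index S x R =
     (LEAST j. j \<notin> R \<and> (\<forall>k. k \<notin> R \<longrightarrow> \<bar>mrd_residual S R k x\<bar> \<le> \<bar>mrd_residual S R j x\<bar>))"

(* mrd_reaches S C x m R: on observing x, the procedure arrives at stage m, the hypotheses
   rejected so far being those with index in R. Arriving at stage M + 1 means that all
   hypotheses have been rejected. *)
inductive mrd_reaches ::
  "((real, 'n::{finite,linorder}) vec, 'n) vec \<Rightarrow> (nat \<Rightarrow> real) \<Rightarrow>
     (real, 'n) vec \<Rightarrow> nat \<Rightarrow> 'n set \<Rightarrow> bool"
  for S C x where
  start: "mrd_reaches S C x 1 {}"
| reject: "mrd_reaches S C x m R \<Longrightarrow> m \<le> CARD('n) \<Longrightarrow>
     C m \<le> \<bar>mrd_residual S R (mrd_index S x R) x\<bar> \<Longrightarrow>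
     mrd_reaches S C x (Suc m) (insert (mrd_index S x R) R)"

definition mrd_rejects ::
  "((real, 'n::{finite,linorder}) vec, 'n) vec \<Rightarrow> (nat \<Rightarrow> real) \<Rightarrow>
     (real, 'n) vec \<Rightarrow> 'n \<Rightarrow> bool" where
  "mrd_rejects S C x i \<longleftrightarrow> (\<exists>m R. mrd_reaches S C x m R \<and> i \<in> R)"

definition mrd_test ::
  "((real, 'n::{finite,linorder}) vec, 'n) vec \<Rightarrow> (nat \<Rightarrow> real) \<Rightarrow> 'n \<Rightarrow> (real, 'n) vec \<Rightarrow> real" where
  "mrd_test S C i x = (if mrd_rejects S C x i then 1 else 0)"

end

theory Submission
  imports Defs "HOL-Complex_Analysis.Cauchy_Integral_Formula"
begin

text \<open>
  Moving the observation along the \<open>i\<close>-th column \<open>g\<close> of \<open>\<Sigma>\<close> changes no residual of another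
  variable and moves every residual of the \<open>i\<close>-th variable affinely. Hence the acceptance region
  of \<open>H\<^sub>i\<close> meets each line parallel to \<open>g\<close> in a bounded interval.

  Such a test is admissible by an argument of Matthes and Truax. For a competitor \<open>\<psi>\<close> of the test
  \<open>\<phi>\<close>, the difference of the powers at \<open>\<mu> = \<Sigma> v\<close> is a positive multiple of the Laplace transform
  at \<open>v\<close> of \<open>F = (\<psi> - \<phi>) exp (- x \<bullet> \<Sigma>\<^sup>-\<^sup>1 x / 2)\<close>, and \<open>\<mu>\<^sub>i = g \<bullet> v\<close>. If \<open>\<psi>\<close> is better, the transform is
  nonpositive on the hyperplane \<open>g \<bullet> v = 0\<close> and nonnegative off it, so it vanishes on the hyperplane
  together with its normal derivative. By uniqueness of the Laplace transform, on almost every line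
  parallel to \<open>g\<close> the function \<open>F\<close> is orthogonal to the affine functions of the parameter \<open>u\<close>. The
  affine function that agrees with \<open>exp u\<close> at the ends of the acceptance interval shows that \<open>F exp u\<close>
  has nonpositive integral on the line, with equality only if \<open>F\<close> vanishes there; but the sum of
  these integrals is the transform at a point with \<open>g \<bullet> v = 1\<close>, hence nonnegative. So \<open>F = 0\<close>.
\<close>

section \<open>Uniqueness of the Laplace transform\<close>

text \<open>One term of the exponential series gives \<open>\<bar>h\<bar> ^ k / fact k \<le> exp
  \<bar>h\<bar> \<le> exp h + exp (- h)\<close>, so the integrability at \<open>s = 1\<close> and
  \<open>s = -1\<close> bounds every moment.\<close>

lemma integrable_mult_power:
  fixes W h :: "'a \<Rightarrow> real"
  assumes [measurable]: "h \<in> borel_measurable M"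
    and int: "\<And>s. integrable M (\<lambda>x. W x * exp (s * h x))"
  shows "integrable M (\<lambda>x. W x * h x ^ k)"
proof -
  have [measurable]: "W \<in> borel_measurable M"
    using borel_measurable_integrable[OF int[of 0]] by simp
  have "integrable M (\<lambda>x. fact k * (\<bar>W x * exp (1 * h x)\<bar> + \<bar>W x * exp (-1 * h x)\<bar>))"
    by (intro integrable_mult_right Bochner_Integration.integrable_add integrable_abs int)
  then show ?thesis
  proof (rule Bochner_Integration.integrable_bound)
    show "AE x in M. norm (W x * h x ^ k)
        \<le> norm (fact k * (\<bar>W x * exp (1 * h x)\<bar> + \<bar>W x * exp (-1 * h x)\<bar>))"
    proof (rule AE_I2)
      fix x
      have "\<bar>h x\<bar> ^ k / fact k \<le> exp \<bar>h x\<bar>"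
        using sum_le_suminf[OF summable_exp_generic[of "\<bar>h x\<bar>"], of "{k}"]
        by (simp add: exp_def divide_inverse mult.commute)
      also have "\<dots> \<le> exp (h x) + exp (- h x)"
        by (cases "h x \<ge> 0") (auto simp: abs_if)
      finally have "\<bar>h x\<bar> ^ k \<le> fact k * (exp (h x) + exp (- h x))"
        by (simp add: field_simps)
      then have "\<bar>W x\<bar> * \<bar>h x\<bar> ^ k \<le> \<bar>W x\<bar> * (fact k * (exp (h x) + exp (- h x)))"
        by (intro mult_left_mono) auto
      then show "norm (W x * h x ^ k)
        \<le> norm (fact k * (\<bar>W x * exp (1 * h x)\<bar> + \<bar>W x * exp (-1 * h x)\<bar>))"
        by (simp add: abs_mult power_abs algebra_simps)
    qed
  qed measurable
qed

text \<open>Expand the exponential and integrate term by term: all partial sums are dominated by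
  \<open>\<bar>W\<bar> * exp (cmod z * \<bar>h\<bar>)\<close>, which two real exponentials control.
  The transform is thereby an entire function of \<open>z\<close> whose coefficients are the real
  moments.\<close>

lemma mgf_power_series:
  fixes W h :: "'a \<Rightarrow> real" and z :: complex
  assumes [measurable]: "h \<in> borel_measurable M"
    and int: "\<And>s. integrable M (\<lambda>x. W x * exp (s * h x))"
  shows "(\<lambda>k. complex_of_real ((LINT x|M. W x * h x ^ k) / fact k) * z ^ k)
    sums (CLINT x|M. of_real (W x) * exp (z * of_real (h x)))"
proof -
  have [measurable]: "W \<in> borel_measurable M"
    using borel_measurable_integrable[OF int[of 0]] by simp
  define T where "T n x = (\<Sum>k<n. complex_of_real (W x * h x ^ k) * (z ^ k / fact k))" for n x
  have [measurable]: "T n \<in> borel_measurable M" for n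
    unfolding T_def by measurable
  have intk: "integrable M (\<lambda>x. W x * h x ^ k)" for k
    by (rule integrable_mult_power[OF _ int]) measurable
  have T: "(CLINT x|M. T n x)
      = (\<Sum>k<n. complex_of_real ((LINT x|M. W x * h x ^ k) / fact k) * z ^ k)" for n
  proof -
    have "(CLINT x|M. T n x)
      = (\<Sum>k<n. CLINT x|M. complex_of_real (W x * h x ^ k) * (z ^ k / fact k))"
      unfolding T_def by (intro Bochner_Integration.integral_sum integrable_mult_left
          integrable_of_real intk)
    also have "\<dots> = (\<Sum>k<n. complex_of_real ((LINT x|M. W x * h x ^ k) / fact k) * z ^ k)"
      by (intro sum.cong refl) (simp only: integral_mult_left_zero integral_complex_of_real, simp)
    finally show ?thesis .
  qed
  let ?w = "\<lambda>x. \<bar>W x * exp (cmod z * h x)\<bar> + \<bar>W x * exp (- cmod z * h x)\<bar>"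
  have "(\<lambda>n. CLINT x|M. T n x) \<longlonglongrightarrow> (CLINT x|M. of_real (W x) * exp (z * of_real (h x)))"
  proof (rule integral_dominated_convergence[where w = ?w])
    show "integrable M ?w"
      by (intro Bochner_Integration.integrable_add integrable_abs int)
    show "AE x in M. (\<lambda>n. T n x) \<longlonglongrightarrow> of_real (W x) * exp (z * of_real (h x))"
    proof (rule AE_I2)
      fix x
      have "(\<lambda>k. of_real (W x) * ((z * of_real (h x)) ^ k /\<^sub>R fact k))
          sums (of_real (W x) * exp (z * of_real (h x)))"
        by (intro sums_mult exp_converges)
      then show "(\<lambda>n. T n x) \<longlonglongrightarrow> of_real (W x) * exp (z * of_real (h x))"
        unfolding T_def sums_def
        by (simp add: scaleR_conv_of_real power_mult_distrib field_simps)
    qed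
    fix n
    show "AE x in M. norm (T n x) \<le> ?w x"
    proof (rule AE_I2)
      fix x
      have "norm (T n x) \<le> (\<Sum>k<n. \<bar>W x\<bar> * ((cmod z * \<bar>h x\<bar>) ^ k /\<^sub>R fact k))"
        unfolding T_def
        by (rule order_trans[OF norm_sum])
           (auto intro!: sum_mono simp: norm_mult norm_divide norm_power abs_mult power_abs
              power_mult_distrib field_simps)
      also have "\<dots> = \<bar>W x\<bar> * (\<Sum>k<n. (cmod z * \<bar>h x\<bar>) ^ k /\<^sub>R fact k)"
        by (simp add: sum_distrib_left)
      also have "\<dots> \<le> \<bar>W x\<bar> * exp (cmod z * \<bar>h x\<bar>)"
        unfolding exp_def
        by (intro mult_left_mono sum_le_suminf[OF summable_exp_generic]) auto
      also have "\<dots> \<le> \<bar>W x\<bar> * (exp (cmod z * h x) + exp (- cmod z * h x))"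
        by (intro mult_left_mono) (auto simp: abs_if)
      finally show "norm (T n x) \<le> ?w x"
        by (simp add: abs_mult algebra_simps)
    qed
  qed measurable
  then show ?thesis
    unfolding sums_def T .
qed

text \<open>The power series of the transform has real coefficients and sums to zero at every real
  argument, so all coefficients vanish. This carries the vanishing over to imaginary arguments,
  where characteristic functions live.\<close>

lemma mgf_zero_imp_complex_zero:
  fixes W h :: "'a \<Rightarrow> real" and z :: complex
  assumes h: "h \<in> borel_measurable M"
    and int: "\<And>s. integrable M (\<lambda>x. W x * exp (s * h x))"
    and zero: "\<And>s. (LINT x|M. W x * exp (s * h x)) = 0"
  shows "(CLINT x|M. of_real (W x) * exp (z * of_real (h x))) = 0"
proof -
  define a where "a k = (LINT x|M. W x * h x ^ k) / fact k" for k
  have ser: "(\<lambda>k. complex_of_real (a k) * z ^ k)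
      sums (CLINT x|M. of_real (W x) * exp (z * of_real (h x)))" for z
    unfolding a_def by (rule mgf_power_series[OF h int])
  have a0: "(\<lambda>k. complex_of_real (a k) * of_real s ^ k) sums 0" for s
  proof -
    have "(CLINT x|M. of_real (W x) * exp (of_real s * of_real (h x)))
        = (CLINT x|M. complex_of_real (W x * exp (s * h x)))"
      by (simp flip: exp_of_real)
    then show ?thesis
      using ser[of "of_real s"] zero[of s] by (simp add: integral_complex_of_real del: of_real_mult)
  qed
  have real0: "(\<lambda>k. a k * s ^ k) sums 0" for s
  proof -
    have "(\<lambda>k. complex_of_real (a k * s ^ k)) sums of_real 0"
      using a0[of s] by simp
    then show ?thesis
      by (simp only: sums_of_real_iff)
  qed
  have "a k = 0" for k
  proof (rule ccontr)
    assume k: "a k \<noteq> 0"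
    have "a 0 = 0"
      using real0[of 0] by simp
    with k have "k > 0" by (cases k) auto
    \<comment> \<open>A series with a nonzero coefficient has no zeros in some punctured
      neighbourhood of 0. Here its sum is the zero function, so the punctured ball would have to be
      empty.\<close>
    obtain s where "0 < s" and s: "\<And>z::real. z \<in> cball 0 s - {0} \<Longrightarrow> 0 \<noteq> (0::real)"
      by (rule powser_0_nonzero[of 1 0 a "\<lambda>_. 0" k]) (use real0 k \<open>k > 0\<close> in auto)
    have "s \<in> cball 0 s - {0}"
      using \<open>0 < s\<close> by simp
    from s[OF this] show False by simp
  qed
  with ser[of z] show ?thesis
    by (simp add: sums_iff)
qed

text \<open>The positive and negative parts of \<open>W\<close>, normalised and pushed forward by
  \<open>h\<close>, are two probability measures on the line. Their characteristic functions agree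
  because the transform of \<open>W\<close> vanishes on the imaginary axis, and Levy's uniqueness
  theorem identifies them.\<close>

lemma mgf_zero_imp_indicator:
  fixes W h :: "'a \<Rightarrow> real"
  assumes h[measurable]: "h \<in> borel_measurable M"
    and int: "\<And>s. integrable M (\<lambda>x. W x * exp (s * h x))"
    and zero: "\<And>s. (LINT x|M. W x * exp (s * h x)) = 0"
    and B[measurable]: "B \<in> sets borel"
  shows "(LINT x|M. W x * indicator B (h x)) = 0"
proof -
  have intW: "integrable M W"
    using int[of 0] by simp
  then have [measurable]: "W \<in> borel_measurable M"
    by simp
  define U V where "U x = max 0 (W x)" and "V x = max 0 (- W x)" for x
  have UV: "U x \<ge> 0" "V x \<ge> 0" "W x = U x - V x" "U x \<le> \<bar>W x\<bar>" "V x \<le> \<bar>W x\<bar>" for x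
    by (auto simp: U_def V_def max_def)
  have [measurable]: "U \<in> borel_measurable M" "V \<in> borel_measurable M"
    unfolding U_def V_def by measurable
  have intUV: "integrable M U" "integrable M V"
    by (rule Bochner_Integration.integrable_bound[OF integrable_abs[OF intW]]; use UV in force)+
  \<comment> \<open>The common mass of the two parts, equal because \<open>s = 0\<close> gives
    \<open>W\<close> integral zero. If it is zero, then \<open>W\<close> vanishes almost everywhere;
    otherwise it is the normalising constant.\<close>
  define c where "c = (LINT x|M. U x)"
  have "(LINT x|M. U x) - (LINT x|M. V x) = (LINT x|M. W x)"
    unfolding UV(3) by (simp add: intUV)
  also have "\<dots> = 0"
    using zero[of 0] by simp
  finally have c: "(LINT x|M. V x) = c"
    by (simp add: c_def)
  show ?thesis
  proof (cases "c = 0")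
    case True
    have "AE x in M. U x = 0" "AE x in M. V x = 0"
      using integral_nonneg_eq_0_iff_AE[OF intUV(1)] integral_nonneg_eq_0_iff_AE[OF intUV(2)]
        True c UV by (auto simp: c_def)
    then have "AE x in M. W x * indicator B (h x) = 0"
      by eventually_elim (simp add: UV(3))
    then show ?thesis
      by (rule integral_eq_zero_AE)
  next
    case False
    have "c \<ge> 0"
      unfolding c_def by (rule Bochner_Integration.integral_nonneg) (simp add: UV)
    with False have "c > 0" by simp
    define N where "N Q = distr (density M (\<lambda>x. ennreal (Q x / c))) borel h" for Q
    have N: "real_distribution (N Q)"
      and Nint: "f \<in> borel_measurable borel \<Longrightarrow>
         (CLINT y|N Q. f y) = (CLINT x|M. complex_of_real (Q x / c) * f (h x))"
      and Nmeas: "measure (N Q) B = (LINT x|M. Q x / c * indicator B (h x))"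
      if [measurable]: "Q \<in> borel_measurable M" and Q: "\<And>x. Q x \<ge> 0"
        and intQ: "integrable M Q" and Qc: "(LINT x|M. Q x) = c"
      for Q and f :: "real \<Rightarrow> complex"
    proof -
      have Q': "Q x / c \<ge> 0" for x
        using Q \<open>c > 0\<close> by simp
      have "emeasure (density M (\<lambda>x. ennreal (Q x / c))) (space M) = (\<integral>\<^sup>+x. ennreal (Q x / c) \<partial>M)"
        by (subst emeasure_density) (auto intro!: nn_integral_cong)
      also have "\<dots> = ennreal (LINT x|M. Q x / c)"
        by (rule nn_integral_eq_integral) (use intQ Q' in auto)
      also have "(LINT x|M. Q x / c) = 1"
        using Qc \<open>c > 0\<close> by simp
      finally have "prob_space (density M (\<lambda>x. ennreal (Q x / c)))"
        by (intro prob_spaceI) simp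
      then interpret prob_space "density M (\<lambda>x. ennreal (Q x / c))" .
      show N: "real_distribution (N Q)"
        unfolding N_def by (rule real_distribution_distr) simp
      show "(CLINT y|N Q. f y) = (CLINT x|M. complex_of_real (Q x / c) * f (h x))"
        if [measurable]: "f \<in> borel_measurable borel"
        unfolding N_def
        by (subst integral_distr, simp, simp, subst integral_density)
           (use Q' in \<open>auto simp: scaleR_conv_of_real\<close>)
      interpret N: real_distribution "N Q" by fact
      have "measure (N Q) B = (LINT y|N Q. indicator B y)"
        by simp
      also have "\<dots> = (LINT x|M. Q x / c * indicator B (h x))"
        unfolding N_def
        by (subst integral_distr, simp, simp, subst integral_density)
           (use Q' in auto)
      finally show "measure (N Q) B = (LINT x|M. Q x / c * indicator B (h x))" .
    qed
    note NU = N[of U, OF _ UV(1) intUV(1) c_def[symmetric], simplified]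
      and NV = N[of V, OF _ UV(2) intUV(2) c, simplified]
    have "char (N U) t = char (N V) t" for t
    proof -
      have eq: "char (N U) t = (CLINT x|M. complex_of_real (U x / c) * iexp (t * h x))"
        "char (N V) t = (CLINT x|M. complex_of_real (V x / c) * iexp (t * h x))"
        unfolding char_def using UV intUV c c_def by (subst Nint; simp)+
      have i: "integrable M (\<lambda>x. complex_of_real (Q x / c) * iexp (t * h x))"
        if "integrable M Q" for Q
      proof (rule Bochner_Integration.integrable_bound)
        show "integrable M (\<lambda>x. Q x / c)"
          using that by simp
        show "AE x in M. norm (complex_of_real (Q x / c) * iexp (t * h x)) \<le> norm (Q x / c)"
          by (simp add: norm_mult norm_divide)
      qed (use that in measurable)
      have "char (N U) t - char (N V) t
         = (CLINT x|M. complex_of_real (U x / c) * iexp (t * h x)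
              - complex_of_real (V x / c) * iexp (t * h x))"
        unfolding eq by (rule Bochner_Integration.integral_diff[symmetric]; intro i intUV)
      also have "\<dots> = (CLINT x|M. (of_real (W x) * exp ((\<i> * of_real t) * of_real (h x))) / of_real c)"
        by (intro Bochner_Integration.integral_cong refl)
           (simp add: UV(3) diff_divide_distrib algebra_simps)
      also have "\<dots> = 0"
        using mgf_zero_imp_complex_zero[OF h int zero] by simp
      finally show ?thesis by simp
    qed
    then have "N U = N V"
      by (intro Levy_uniqueness NU NV ext)
    then have "(LINT x|M. U x / c * indicator B (h x)) = (LINT x|M. V x / c * indicator B (h x))"
      using Nmeas[of U] Nmeas[of V] UV(1,2) intUV c c_def by (metis borel_measurable_integrable)
    moreover have i: "integrable M (\<lambda>x. Q x / c * indicator B (h x))"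
        if "integrable M Q" for Q
    proof (rule Bochner_Integration.integrable_bound)
      show "integrable M (\<lambda>x. Q x / c)"
        using that by simp
      show "AE x in M. norm (Q x / c * indicator B (h x)) \<le> norm (Q x / c)"
        by (auto split: split_indicator)
    qed (use that in measurable)
    ultimately have "0 = (LINT x|M. U x / c * indicator B (h x) - V x / c * indicator B (h x))"
      by (simp only: Bochner_Integration.integral_diff[OF i[OF intUV(1)] i[OF intUV(2)]])
    also have "\<dots> = (LINT x|M. (W x * indicator B (h x)) / c)"
      by (intro Bochner_Integration.integral_cong refl) (simp add: UV(3) left_diff_distrib diff_divide_distrib)
    finally show ?thesis
      using \<open>c > 0\<close> by simp
  qed
qed

section \<open>The transform in several variables\<close>

text \<open>The class on which the Laplace transform is finite everywhere. It is stable under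
  domination and under multiplication by exponentials and by linear forms, and it contains the
  Gaussian functions; hence every function transformed below stays in it.\<close>

definition all_exp_integrable :: "('a::euclidean_space \<Rightarrow> real) \<Rightarrow> bool" where
  "all_exp_integrable W \<longleftrightarrow> (\<forall>v. integrable lborel (\<lambda>x. W x * exp (x \<bullet> v)))"

lemma all_exp_integrableD:
  assumes "all_exp_integrable W"
  shows "integrable lborel (\<lambda>x. W x * exp (x \<bullet> v))" "integrable lborel W"
    "W \<in> borel_measurable borel"
proof -
  show "integrable lborel (\<lambda>x. W x * exp (x \<bullet> v))" for v
    using assms by (simp add: all_exp_integrable_def)
  from this[of 0] show "integrable lborel W" by simp
  then show "W \<in> borel_measurable borel"
    using borel_measurable_integrable by force
qed

lemma all_exp_integrable_bound:
  assumes U: "all_exp_integrable U" and [measurable]: "W \<in> borel_measurable borel"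
    and le: "\<And>x. \<bar>W x\<bar> \<le> \<bar>U x\<bar>"
  shows "all_exp_integrable W"
  unfolding all_exp_integrable_def
proof
  fix v
  show "integrable lborel (\<lambda>x. W x * exp (x \<bullet> v))"
    by (rule Bochner_Integration.integrable_bound[OF all_exp_integrableD(1)[OF U, of v]])
       (auto simp: abs_mult intro!: mult_right_mono le)
qed

lemma all_exp_integrable_mult_exp:
  assumes "all_exp_integrable W"
  shows "all_exp_integrable (\<lambda>x. W x * exp (x \<bullet> v))"
  unfolding all_exp_integrable_def
proof
  fix w
  show "integrable lborel (\<lambda>x. W x * exp (x \<bullet> v) * exp (x \<bullet> w))"
    using all_exp_integrableD(1)[OF assms, of "v + w"]
    by (simp add: inner_add_right exp_add mult.assoc)
qed

lemma all_exp_integrable_mult_inner: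
  assumes W: "all_exp_integrable W"
  shows "all_exp_integrable (\<lambda>x. W x * (x \<bullet> p))"
  unfolding all_exp_integrable_def
proof
  fix v
  have "integrable lborel (\<lambda>x. (W x * exp (x \<bullet> v)) * exp (s * (x \<bullet> p)))" for s
    using all_exp_integrableD(1)[OF all_exp_integrable_mult_exp[OF W, of v], of "s *\<^sub>R p"]
    by simp
  from integrable_mult_power[OF _ this, of 1]
  show "integrable lborel (\<lambda>x. W x * (x \<bullet> p) * exp (x \<bullet> v))"
    by (simp add: mult_ac)
qed

text \<open>The integrand is a product of functions of the single coordinates, and each factor is a
  constant times a normal density.\<close>

lemma all_exp_integrable_gaussian:
  assumes "0 < \<kappa>"
  shows "all_exp_integrable (\<lambda>x::'a::euclidean_space. exp (- \<kappa> * (norm x)\<^sup>2))"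
  unfolding all_exp_integrable_def
proof
  fix v :: 'a
  define f where "f b t = exp (- \<kappa> * t\<^sup>2 + t * (v \<bullet> b))" for b :: 'a and t :: real
  have fint: "integrable lborel (f b)" for b
  proof -
    \<comment> \<open>Mean and, with the next line, standard deviation obtained by completing the
      square in the exponent of \<open>f b\<close>.\<close>
    define m where "m = (v \<bullet> b) / (2 * \<kappa>)"
    define \<sigma> where "\<sigma> = sqrt (1 / (2 * \<kappa>))"
    have \<sigma>: "\<sigma>\<^sup>2 = 1 / (2 * \<kappa>)"
      using assms by (simp add: \<sigma>_def)
    have "f b t = exp (\<kappa> * m\<^sup>2) * sqrt (2 * pi * \<sigma>\<^sup>2) * normal_density m \<sigma> t" for t
    proof -
      have "(t - m)\<^sup>2 / (2 * \<sigma>\<^sup>2) = \<kappa> * (t - m)\<^sup>2"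
        unfolding \<sigma> using assms by simp
      moreover have "- \<kappa> * t\<^sup>2 + t * (v \<bullet> b) = \<kappa> * m\<^sup>2 - \<kappa> * (t - m)\<^sup>2"
        using assms by (simp add: m_def power2_eq_square field_simps)
      moreover have "\<sigma> \<noteq> 0"
        using \<sigma> assms by auto
      ultimately show ?thesis
        by (simp add: f_def normal_density_def flip: exp_add)
    qed
    then have "f b = (\<lambda>t. exp (\<kappa> * m\<^sup>2) * sqrt (2 * pi * \<sigma>\<^sup>2) * normal_density m \<sigma> t)"
      by blast
    moreover have "0 < \<sigma>"
      using assms by (simp add: \<sigma>_def)
    ultimately show ?thesis
      by simp
  qed
  have eq: "exp (- \<kappa> * (norm x)\<^sup>2) * exp (x \<bullet> v) = (\<Prod>b\<in>Basis. f b (x \<bullet> b))" for x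
  proof -
    have "- \<kappa> * (norm x)\<^sup>2 + x \<bullet> v = (\<Sum>b\<in>Basis. - \<kappa> * (x \<bullet> b)\<^sup>2 + (x \<bullet> b) * (v \<bullet> b))"
      unfolding power2_norm_eq_inner
      by (subst (1 2) euclidean_inner)
         (simp add: sum_distrib_left sum.distrib sum_negf power2_eq_square sum_subtractf)
    then show ?thesis
      by (simp add: f_def exp_sum flip: exp_add)
  qed
  have "(\<integral>\<^sup>+x. (\<Prod>b\<in>Basis. ennreal (f b (x \<bullet> b))) \<partial>lborel) = (\<Prod>b\<in>Basis. (\<integral>\<^sup>+t. ennreal (f b t) \<partial>lborel))"
    by (rule nn_integral_lborel_prod) (auto simp: f_def)
  also have "\<dots> < \<infinity>"
  proof -
    have "(\<integral>\<^sup>+t. ennreal (f b t) \<partial>lborel) = ennreal (LINT t|lborel. f b t)" for b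
      by (rule nn_integral_eq_integral[OF fint]) (simp add: f_def)
    moreover have "0 \<le> (LINT t|lborel. f b t)" for b
      by (rule Bochner_Integration.integral_nonneg) (simp add: f_def)
    ultimately show ?thesis
      by (simp add: prod_ennreal)
  qed
  finally show "integrable lborel (\<lambda>x. exp (- \<kappa> * (norm x)\<^sup>2) * exp (x \<bullet> v))"
    unfolding eq integrable_iff_bounded
    by (simp add: f_def prod_nonneg abs_prod flip: prod_ennreal)
qed

text \<open>With respect to the statistic \<open>x \<bullet> j\<close>, the parameter
  \<open>s\<close> merely shifts \<open>v\<close> to \<open>v + s *\<^sub>R j\<close>, so the
  one-variable result applies to \<open>W x * exp (x \<bullet> v)\<close>. Both hypotheses on
  \<open>W\<close> survive the cut-off, which allows one coordinate after another to be cut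
  off.\<close>

lemma laplace_zero_indicator:
  fixes W :: "'a::euclidean_space \<Rightarrow> real"
  assumes W: "all_exp_integrable W" and zero: "\<And>v. (LINT x|lborel. W x * exp (x \<bullet> v)) = 0"
    and [measurable]: "B \<in> sets borel"
  shows "all_exp_integrable (\<lambda>x. W x * indicator B (x \<bullet> j))"
    "(LINT x|lborel. W x * indicator B (x \<bullet> j) * exp (x \<bullet> v)) = 0"
proof -
  have [measurable]: "W \<in> borel_measurable borel"
    using W by (rule all_exp_integrableD)
  show "all_exp_integrable (\<lambda>x. W x * indicator B (x \<bullet> j))"
    by (rule all_exp_integrable_bound[OF W]) (auto split: split_indicator)
  have eq: "W x * exp (x \<bullet> v) * exp (s * (x \<bullet> j)) = W x * exp (x \<bullet> (v + s *\<^sub>R j))" for x s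
    by (simp add: inner_add_right exp_add mult.assoc)
  have "(LINT x|lborel. (W x * exp (x \<bullet> v)) * indicator B (x \<bullet> j)) = 0"
    by (rule mgf_zero_imp_indicator)
       (simp_all only: eq zero all_exp_integrableD(1)[OF W], measurable)
  then show "(LINT x|lborel. W x * indicator B (x \<bullet> j) * exp (x \<bullet> v)) = 0"
    by (simp add: mult_ac)
qed

text \<open>Cutting off all coordinates shows that \<open>W\<close> integrates to zero over every
  orthant \<open>{..a}\<close>. The orthants are closed under intersection and generate the Borel
  sets, so the positive and negative parts of \<open>W\<close> are densities of the same
  measure.\<close>

lemma laplace_zero_imp_AE_zero:
  fixes W :: "'a::ordered_euclidean_space \<Rightarrow> real"
  assumes W: "all_exp_integrable W" and zero: "\<And>v. (LINT x|lborel. W x * exp (x \<bullet> v)) = 0"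
  shows "AE x in lborel. W x = 0"
proof -
  have [measurable]: "W \<in> borel_measurable borel"
    using W by (rule all_exp_integrableD)
  have intW: "integrable lborel W"
    using W by (rule all_exp_integrableD)
  have box: "(LINT x|lborel. W x * indicator {..a} x) = 0" for a
  proof -
    define Q where "Q J x = W x * (\<Prod>j\<in>J. indicator {..a \<bullet> j} (x \<bullet> j))" for J x
    have "all_exp_integrable (Q J) \<and> (\<forall>v. (LINT x|lborel. Q J x * exp (x \<bullet> v)) = 0)"
      if "finite J" for J
      using that
    proof induction
      case empty
      then show ?case using W zero by (simp add: Q_def)
    next
      case (insert j J)
      have "Q (insert j J) = (\<lambda>x. Q J x * indicator {..a \<bullet> j} (x \<bullet> j))"
        using insert.hyps by (auto simp: Q_def mult_ac)
      then show ?case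
        using laplace_zero_indicator[of "Q J" "{..a \<bullet> j}" j] insert.IH by simp
    qed
    from this[of Basis] have "(LINT x|lborel. Q Basis x) = 0"
      by (auto dest: spec[of _ 0])
    moreover have "(\<Prod>j\<in>Basis. indicator {..a \<bullet> j} (x \<bullet> j)) = (indicator {..a} x :: real)" for x
      by (auto simp: indicator_def eucl_le[where 'a = 'a])
    ultimately show ?thesis
      by (simp add: Q_def)
  qed
  define U V where "U x = max 0 (W x)" and "V x = max 0 (- W x)" for x
  have UV: "U x \<ge> 0" "V x \<ge> 0" "W x = U x - V x" "U x \<le> \<bar>W x\<bar>" "V x \<le> \<bar>W x\<bar>" for x
    by (auto simp: U_def V_def max_def)
  have [measurable]: "U \<in> borel_measurable borel" "V \<in> borel_measurable borel"
    unfolding U_def V_def by measurable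
  have intUV: "integrable lborel U" "integrable lborel V"
    by (rule Bochner_Integration.integrable_bound[OF integrable_abs[OF intW]]; use UV in force)+
  have em: "emeasure (density lborel (\<lambda>x. ennreal (Q x))) {..a} = ennreal (LINT x|lborel. Q x * indicator {..a} x)"
    and ai: "integrable lborel (\<lambda>x. Q x * indicator {..a} x)"
    if Q: "\<And>x. Q x \<ge> 0" and intQ: "integrable lborel Q" and [measurable]: "Q \<in> borel_measurable borel"
    for Q and a :: 'a
  proof -
    show i: "integrable lborel (\<lambda>x. Q x * indicator {..a} x)"
      by (rule Bochner_Integration.integrable_bound[OF intQ]) (auto split: split_indicator)
    have "emeasure (density lborel (\<lambda>x. ennreal (Q x))) {..a} = (\<integral>\<^sup>+x. ennreal (Q x * indicator {..a} x) \<partial>lborel)"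
      by (subst emeasure_density) (auto intro!: nn_integral_cong split: split_indicator)
    also have "\<dots> = ennreal (LINT x|lborel. Q x * indicator {..a} x)"
      by (rule nn_integral_eq_integral[OF i]) (use Q in auto)
    finally show "emeasure (density lborel (\<lambda>x. ennreal (Q x))) {..a} = ennreal (LINT x|lborel. Q x * indicator {..a} x)" .
  qed
  have "density lborel (\<lambda>x. ennreal (U x)) = density lborel (\<lambda>x. ennreal (V x))"
  proof (rule measure_eqI_generator_eq[where E = "range (\<lambda>a::'a. {..a})" and \<Omega> = UNIV
        and A = "\<lambda>n. {..real n *\<^sub>R One}"])
    show "Int_stable (range (\<lambda>a::'a. {..a}))"
    proof -
      have "{..a} \<inter> {..b} = {..inf a b}" for a b :: 'a
        by auto
      then show ?thesis
        by (auto simp: Int_stable_def)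
    qed
    show "(\<Union>i. {..real i *\<^sub>R One}) = (UNIV :: 'a set)"
    proof (intro equalityI subsetI UNIV_I)
      fix x :: 'a
      obtain n :: nat where n: "norm x \<le> real n"
        using real_arch_simple by blast
      have "x \<le> real n *\<^sub>R One"
        unfolding eucl_le[where 'a = 'a]
      proof
        fix i :: 'a assume "i \<in> Basis"
        then show "x \<bullet> i \<le> (real n *\<^sub>R One) \<bullet> i"
          using Basis_le_norm[of i x] n by simp
      qed
      then show "x \<in> (\<Union>i. {..real i *\<^sub>R One})"
        by auto
    qed
    show "sets (density lborel (\<lambda>x. ennreal (U x))) = sigma_sets UNIV (range (\<lambda>a::'a. {..a}))"
      "sets (density lborel (\<lambda>x. ennreal (V x))) = sigma_sets UNIV (range (\<lambda>a::'a. {..a}))"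
      by (simp_all add: borel_eq_atMost)
    show "emeasure (density lborel (\<lambda>x. ennreal (U x))) X = emeasure (density lborel (\<lambda>x. ennreal (V x))) X"
      if "X \<in> range (\<lambda>a::'a. {..a})" for X
    proof -
      from that obtain a where X: "X = {..a}" by auto
      have "(LINT x|lborel. U x * indicator {..a} x) - (LINT x|lborel. V x * indicator {..a} x)
          = (LINT x|lborel. W x * indicator {..a} x)"
        unfolding UV(3) left_diff_distrib
        by (rule Bochner_Integration.integral_diff[symmetric]; rule ai) (use UV intUV in auto)
      then show ?thesis
        unfolding X by (simp add: em UV(1,2) intUV box)
    qed
    show "emeasure (density lborel (\<lambda>x. ennreal (U x))) {..real i *\<^sub>R One} \<noteq> \<infinity>" for i
      by (simp add: em UV intUV)
  qed auto
  then have "AE x in lborel. ennreal (U x) = ennreal (V x)"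
    by (subst (asm) sigma_finite_measure.density_unique_iff[OF sigma_finite_lborel]) auto
  then show ?thesis
    by eventually_elim (simp add: UV)
qed

section \<open>Integrals along parallel lines\<close>

text \<open>The map is a composition of two measure-preserving ones: the shear
  \<open>(x, r) \<mapsto> (x + r *\<^sub>R g, r)\<close>, followed by
  \<open>(x, r) \<mapsto> (x, x \<bullet> p - r)\<close>, which recovers the old value of
  \<open>x \<bullet> p\<close> because \<open>g \<bullet> p = 1\<close>.\<close>

lemma distr_shear_lborel:
  fixes g p :: "'a::euclidean_space"
  assumes gp: "g \<bullet> p = 1"
  shows "distr (lborel \<Otimes>\<^sub>M lborel) (lborel \<Otimes>\<^sub>M lborel) (\<lambda>(x, r). (x + r *\<^sub>R g, x \<bullet> p))
    = lborel \<Otimes>\<^sub>M (lborel :: real measure)" (is "distr ?N ?N ?T = ?N")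
proof (rule measure_eqI)
  have [measurable]: "?T \<in> measurable ?N ?N"
    by measurable
  fix A assume "A \<in> sets (distr ?N ?N ?T)"
  then have A[measurable]: "A \<in> sets ?N" by simp
  define f :: "'a \<times> real \<Rightarrow> ennreal" where "f = indicator A"
  have [measurable]: "f \<in> borel_measurable ?N"
    unfolding f_def by measurable
  have shift: "(\<integral>\<^sup>+x. k (x + c) \<partial>lborel) = (\<integral>\<^sup>+x. k x \<partial>lborel)"
    if [measurable]: "k \<in> borel_measurable borel" for c :: 'a and k :: "'a \<Rightarrow> ennreal"
    by (subst (2) lborel_distr_plus[symmetric, of c]) (simp add: nn_integral_distr add.commute)
  have "emeasure (distr ?N ?N ?T) A = (\<integral>\<^sup>+y. f y \<partial>distr ?N ?N ?T)"
    unfolding f_def by (rule nn_integral_indicator[symmetric]) (use A in simp)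
  also have "\<dots> = (\<integral>\<^sup>+z. f (?T z) \<partial>?N)"
    by (rule nn_integral_distr) measurable
  also have "\<dots> = (\<integral>\<^sup>+r. \<integral>\<^sup>+x. f (x + r *\<^sub>R g, x \<bullet> p) \<partial>lborel \<partial>lborel)"
    by (subst lborel_pair.nn_integral_snd[symmetric]) auto
  \<comment> \<open>For fixed \<open>r\<close>, a translation by
    \<open>r *\<^sub>R g\<close>.\<close>
  also have "\<dots> = (\<integral>\<^sup>+r. \<integral>\<^sup>+x. f (x, x \<bullet> p - r) \<partial>lborel \<partial>lborel)"
  proof (rule nn_integral_cong)
    fix r :: real
    have "(\<integral>\<^sup>+x. f (x + r *\<^sub>R g, (x + r *\<^sub>R g) \<bullet> p - r) \<partial>lborel) = (\<integral>\<^sup>+x. f (x, x \<bullet> p - r) \<partial>lborel)"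
      by (rule shift) measurable
    then show "(\<integral>\<^sup>+x. f (x + r *\<^sub>R g, x \<bullet> p) \<partial>lborel) = (\<integral>\<^sup>+x. f (x, x \<bullet> p - r) \<partial>lborel)"
      by (simp add: inner_add_left gp)
  qed
  also have "\<dots> = (\<integral>\<^sup>+x. \<integral>\<^sup>+r. f (x, x \<bullet> p - r) \<partial>lborel \<partial>lborel)"
    by (rule lborel_pair.Fubini') measurable
  \<comment> \<open>For fixed \<open>x\<close>, a reflection of the line.\<close>
  also have "\<dots> = (\<integral>\<^sup>+x. \<integral>\<^sup>+r. f (x, r) \<partial>lborel \<partial>lborel)"
  proof (rule nn_integral_cong)
    fix x :: 'a
    show "(\<integral>\<^sup>+r. f (x, x \<bullet> p - r) \<partial>lborel) = (\<integral>\<^sup>+r. f (x, r) \<partial>lborel)"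
      by (subst (2) nn_integral_real_affine[where c = "-1" and t = "x \<bullet> p"]) auto
  qed
  also have "\<dots> = (\<integral>\<^sup>+z. f z \<partial>?N)"
    by (rule lborel.nn_integral_fst) measurable
  also have "\<dots> = emeasure ?N A"
    unfolding f_def by (rule nn_integral_indicator) (rule A)
  finally show "emeasure (distr ?N ?N ?T) A = emeasure ?N A" .
qed simp

text \<open>The factor that the Gaussian weight contributes to transforms of line integrals. Only
  its positivity is used, so no closed form is computed.\<close>

definition gauss_laplace :: "real \<Rightarrow> real" where
  "gauss_laplace c = (LINT t|lborel. exp (- t\<^sup>2) * exp (t * c))"

lemma integrable_gauss_exp: "integrable lborel (\<lambda>t::real. exp (- t\<^sup>2) * exp (t * c))"
  using all_exp_integrableD(1)[OF all_exp_integrable_gaussian[of 1, where 'a = real], of c] by simp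

lemma gauss_laplace_nonzero: "gauss_laplace c \<noteq> 0"
proof
  assume "gauss_laplace c = 0"
  then have "AE t in lborel. exp (- t\<^sup>2) * exp (t * c) = 0"
    unfolding gauss_laplace_def
    by (subst (asm) integral_nonneg_eq_0_iff_AE[OF integrable_gauss_exp]) auto
  then have "AE t::real in lborel. False"
    by eventually_elim simp
  then show False
    by (simp add: ae_filter_eq_bot_iff eventually_False)
qed

lemma gauss_laplace_pos: "0 < gauss_laplace c"
proof -
  have "0 \<le> gauss_laplace c"
    unfolding gauss_laplace_def by (rule Bochner_Integration.integral_nonneg) simp
  with gauss_laplace_nonzero[of c] show ?thesis
    by simp
qed

definition line_integral :: "'a::euclidean_space \<Rightarrow> ('a \<Rightarrow> real) \<Rightarrow> 'a \<Rightarrow> real" where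
  "line_integral g F x = (LINT r|lborel. F (x + r *\<^sub>R g))"

text \<open>
  A line integral is constant along \<open>g\<close> and so not integrable over the whole space; the Gaussian
  weight in the coordinate \<open>x \<bullet> p\<close> only restores integrability.
\<close>

lemma
  fixes F :: "'a::euclidean_space \<Rightarrow> real"
  assumes gp: "g \<bullet> p = 1" and F: "all_exp_integrable F"
  shows AE_integrable_line: "AE x in lborel. integrable lborel (\<lambda>r. F (x + r *\<^sub>R g))"
    and integrable_line_integral:
      "integrable lborel (\<lambda>x. line_integral g F x * exp (- (x \<bullet> p)\<^sup>2) * exp (x \<bullet> v))"
    and integral_line_integral:
      "(LINT x|lborel. line_integral g F x * exp (- (x \<bullet> p)\<^sup>2) * exp (x \<bullet> v))
        = gauss_laplace (g \<bullet> v) * (LINT x|lborel. F x * exp (x \<bullet> (v - (g \<bullet> v) *\<^sub>R p)))"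
proof -
  let ?N = "lborel \<Otimes>\<^sub>M lborel :: ('a \<times> real) measure"
  let ?T = "\<lambda>(x, r). (x + r *\<^sub>R g, x \<bullet> p)"
  have [measurable]: "F \<in> borel_measurable borel"
    using F by (rule all_exp_integrableD)
  \<comment> \<open>The projection of \<open>v\<close> along \<open>p\<close> onto the hyperplane
    orthogonal to \<open>g\<close>. After the shear, the exponent \<open>x \<bullet> v\<close>
    splits into a part in the point on the line, paired with \<open>v' v\<close>, and a part in the
    weight variable, paired with \<open>g \<bullet> v\<close>; so \<open>\<Phi>\<close> is a
    product.\<close>
  define v' where "v' v = v - (g \<bullet> v) *\<^sub>R p" for v
  define \<Phi> where "\<Phi> v = (\<lambda>(x, t). (F x * exp (x \<bullet> v' v)) * (exp (- t\<^sup>2) * exp (t * (g \<bullet> v))))" for v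
  have [measurable]: "\<Phi> v \<in> borel_measurable ?N" for v
    unfolding \<Phi>_def by measurable
  have [measurable]: "?T \<in> measurable ?N ?N"
    by measurable
  have \<Phi>: "integrable ?N (\<Phi> v)" for v
  proof (rule lborel_pair.Fubini_integrable)
    have "integrable lborel (\<lambda>x. \<bar>F x * exp (x \<bullet> v' v)\<bar> * gauss_laplace (g \<bullet> v))"
      by (intro integrable_mult_left integrable_abs all_exp_integrableD(1)[OF F])
    moreover have "(LINT t|lborel. norm (\<Phi> v (x, t))) = \<bar>F x * exp (x \<bullet> v' v)\<bar> * gauss_laplace (g \<bullet> v)" for x
      unfolding gauss_laplace_def integral_mult_right_zero[symmetric] by (simp add: \<Phi>_def abs_mult)
    ultimately show "integrable lborel (\<lambda>x. LINT t|lborel. norm (\<Phi> v (x, t)))"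
      by simp
    show "AE x in lborel. integrable lborel (\<lambda>t. \<Phi> v (x, t))"
      unfolding \<Phi>_def by (auto intro!: AE_I2 integrable_mult_right integrable_gauss_exp)
  qed measurable
  define \<Psi> where "\<Psi> v = (\<lambda>(x, r). F (x + r *\<^sub>R g) * (exp (- (x \<bullet> p)\<^sup>2) * exp (x \<bullet> v)))" for v
  have \<Psi>_eq: "\<Psi> v = (\<lambda>z. \<Phi> v (?T z))" for v
  proof -
    have "(x + r *\<^sub>R g) \<bullet> v' v + x \<bullet> p * (g \<bullet> v) = x \<bullet> v" for x r
      by (simp add: v'_def inner_simps gp algebra_simps)
    then have "exp (x \<bullet> v) = exp ((x + r *\<^sub>R g) \<bullet> v' v) * exp (x \<bullet> p * (g \<bullet> v))" for x r
      by (metis exp_add)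
    then show ?thesis
      by (auto simp: \<Psi>_def \<Phi>_def mult_ac)
  qed
  have \<Psi>: "integrable ?N (\<Psi> v)" for v
    unfolding \<Psi>_eq using \<Phi>[of v]
    by (subst (asm) distr_shear_lborel[OF gp, symmetric], subst (asm) integrable_distr_eq) auto
  have line: "(LINT r|lborel. \<Psi> v (x, r)) = line_integral g F x * exp (- (x \<bullet> p)\<^sup>2) * exp (x \<bullet> v)" for x v
    by (simp add: \<Psi>_def line_integral_def)
  show "AE x in lborel. integrable lborel (\<lambda>r. F (x + r *\<^sub>R g))"
    using lborel_pair.AE_integrable_fst'[OF \<Psi>[of 0]]
    by eventually_elim (simp add: \<Psi>_def)
  show "integrable lborel (\<lambda>x. line_integral g F x * exp (- (x \<bullet> p)\<^sup>2) * exp (x \<bullet> v))"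
    using lborel_pair.integrable_fst'[OF \<Psi>[of v]] by (simp add: line)
  have "(LINT x|lborel. line_integral g F x * exp (- (x \<bullet> p)\<^sup>2) * exp (x \<bullet> v)) = (LINT z|?N. \<Psi> v z)"
    using lborel_pair.integral_fst'[OF \<Psi>[of v]] by (simp add: line)
  also have "\<dots> = (LINT z|?N. \<Phi> v z)"
    unfolding \<Psi>_eq by (subst (2) distr_shear_lborel[OF gp, symmetric], subst integral_distr) auto
  also have "\<dots> = (LINT x|lborel. LINT t|lborel. \<Phi> v (x, t))"
    by (rule lborel_pair.integral_fst'[OF \<Phi>, symmetric])
  also have "\<dots> = (LINT x|lborel. (F x * exp (x \<bullet> v' v)) * gauss_laplace (g \<bullet> v))"
    by (simp add: \<Phi>_def gauss_laplace_def)
  also have "\<dots> = gauss_laplace (g \<bullet> v) * (LINT x|lborel. F x * exp (x \<bullet> (v - (g \<bullet> v) *\<^sub>R p)))"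
    by (simp add: v'_def)
  finally show "(LINT x|lborel. line_integral g F x * exp (- (x \<bullet> p)\<^sup>2) * exp (x \<bullet> v))
        = gauss_laplace (g \<bullet> v) * (LINT x|lborel. F x * exp (x \<bullet> (v - (g \<bullet> v) *\<^sub>R p)))" .
qed

text \<open>The transform of the weighted line integral at any \<open>v\<close> is a multiple of the
  transform of \<open>F\<close> at \<open>v - (g \<bullet> v) *\<^sub>R p\<close>, a point of the
  hyperplane. It therefore vanishes everywhere, and uniqueness applies.\<close>

lemma laplace_zero_imp_line_integral_zero:
  fixes F :: "'a::ordered_euclidean_space \<Rightarrow> real"
  assumes gp: "g \<bullet> p = 1" and F: "all_exp_integrable F"
    and zero: "\<And>v. g \<bullet> v = 0 \<Longrightarrow> (LINT x|lborel. F x * exp (x \<bullet> v)) = 0"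
  shows "AE x in lborel. line_integral g F x = 0"
proof -
  have "AE x in lborel. line_integral g F x * exp (- (x \<bullet> p)\<^sup>2) = 0"
  proof (rule laplace_zero_imp_AE_zero)
    show "all_exp_integrable (\<lambda>x. line_integral g F x * exp (- (x \<bullet> p)\<^sup>2))"
      unfolding all_exp_integrable_def using integrable_line_integral[OF gp F] by blast
    show "(LINT x|lborel. line_integral g F x * exp (- (x \<bullet> p)\<^sup>2) * exp (x \<bullet> v)) = 0" for v
      unfolding integral_line_integral[OF gp F]
      by (subst zero) (simp_all add: inner_diff_right gp)
  qed
  then show ?thesis
    by eventually_elim simp
qed

text \<open>At \<open>v = 0\<close> the weighted line integral has total integral a positive
  multiple of that of \<open>F\<close>. A nonpositive function with nonnegative integral is zero
  almost everywhere.\<close>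

lemma line_integral_nonpos_imp_zero:
  fixes F :: "'a::euclidean_space \<Rightarrow> real"
  assumes gp: "g \<bullet> p = 1" and F: "all_exp_integrable F"
    and np: "AE x in lborel. line_integral g F x \<le> 0" and nn: "0 \<le> (LINT x|lborel. F x)"
  shows "AE x in lborel. line_integral g F x = 0"
proof -
  let ?K = "\<lambda>x. line_integral g F x * exp (- (x \<bullet> p)\<^sup>2)"
  have int: "integrable lborel ?K" and eq: "(LINT x|lborel. ?K x) = gauss_laplace 0 * (LINT x|lborel. F x)"
    using integrable_line_integral[OF gp F, of 0] integral_line_integral[OF gp F, of 0] by auto
  have np': "AE x in lborel. 0 \<le> - ?K x"
    using np by eventually_elim (simp add: mult_nonpos_nonneg)
  have "(LINT x|lborel. - ?K x) \<le> 0"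
    using eq nn gauss_laplace_pos[of 0] by simp
  moreover have "0 \<le> (LINT x|lborel. - ?K x)"
    by (rule integral_nonneg_AE[OF np'])
  ultimately have "AE x in lborel. - ?K x = 0"
    using integral_nonneg_eq_0_iff_AE[OF integrable_minus[OF int] np'] by simp
  then show ?thesis
    by eventually_elim simp
qed

text \<open>The line integrals of \<open>\<bar>F\<bar>\<close> vanish, hence so does the integral of
  \<open>\<bar>F\<bar>\<close> over the space.\<close>

lemma line_AE_zero_imp_AE_zero:
  fixes F :: "'a::euclidean_space \<Rightarrow> real"
  assumes gp: "g \<bullet> p = 1" and F: "all_exp_integrable F"
    and zero: "AE x in lborel. AE r in lborel. F (x + r *\<^sub>R g) = 0"
  shows "AE x in lborel. F x = 0"
proof -
  let ?A = "\<lambda>x. \<bar>F x\<bar>"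
  have [measurable]: "F \<in> borel_measurable borel"
    using F by (rule all_exp_integrableD)
  have A: "all_exp_integrable ?A"
    by (rule all_exp_integrable_bound[OF F]) auto
  have "AE x in lborel. line_integral g ?A x = 0"
    using zero
  proof eventually_elim
    case (elim x)
    then have "AE r in lborel. \<bar>F (x + r *\<^sub>R g)\<bar> = 0"
      by eventually_elim simp
    then show ?case
      unfolding line_integral_def by (rule integral_eq_zero_AE)
  qed
  then have "AE x in lborel. line_integral g ?A x * exp (- (x \<bullet> p)\<^sup>2) * exp (x \<bullet> 0) = 0"
    by eventually_elim simp
  from integral_eq_zero_AE[OF this] have "gauss_laplace 0 * (LINT x|lborel. ?A x) = 0"
    using integral_line_integral[OF gp A, of 0] by simp
  then have "(LINT x|lborel. ?A x) = 0"
    using gauss_laplace_pos[of 0] by simp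
  then have "AE x in lborel. ?A x = 0"
    by (subst (asm) integral_nonneg_eq_0_iff_AE[OF all_exp_integrableD(2)[OF A]]) auto
  then show ?thesis
    by eventually_elim simp
qed

section \<open>Laplace transforms with a sign\<close>

text \<open>Supplies a dominating function, free of \<open>t\<close>, for the difference quotients
  of \<open>exp (t * u)\<close> at \<open>t = 0\<close>. It rests on \<open>\<bar>exp y - 1\<bar>
  \<le> \<bar>y\<bar> * exp \<bar>y\<bar>\<close> and
  \<open>\<bar>u\<bar> \<le> exp \<bar>u\<bar>\<close>.\<close>

lemma abs_exp_minus_one_le:
  fixes t u :: real
  assumes t: "0 \<le> t" "t \<le> 1"
  shows "\<bar>exp (t * u) - 1\<bar> \<le> t * (2 * (exp (2 * u) + exp (-2 * u)))"
proof -
  have up: "exp y - 1 \<le> y * exp y" for y :: real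
  proof -
    have "(1 - y) * exp y \<le> exp (- y) * exp y"
      using exp_ge_add_one_self[of "- y"] by (intro mult_right_mono) auto
    then show ?thesis
      by (simp add: algebra_simps flip: exp_add)
  qed
  have "\<bar>exp (t * u) - 1\<bar> \<le> \<bar>t * u\<bar> * exp \<bar>t * u\<bar>"
  proof (cases "t * u \<ge> 0")
    case True
    then show ?thesis
      using up[of "t * u"] by simp
  next
    case False
    then have "1 - exp (t * u) \<le> \<bar>t * u\<bar> * 1"
      using exp_ge_add_one_self[of "t * u"] by linarith
    also have "\<dots> \<le> \<bar>t * u\<bar> * exp \<bar>t * u\<bar>"
      by (intro mult_left_mono) auto
    finally show ?thesis
      using False by simp
  qed
  also have "\<dots> \<le> (t * \<bar>u\<bar>) * exp \<bar>u\<bar>"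
    using t by (intro mult_mono) (auto simp: abs_mult mult_left_le_one_le)
  also have "\<dots> \<le> (t * exp \<bar>u\<bar>) * exp \<bar>u\<bar>"
    using t exp_gt_self[of "\<bar>u\<bar>"] by (intro mult_right_mono mult_left_mono) auto
  also have "\<dots> = t * exp (2 * \<bar>u\<bar>)"
    by (simp flip: exp_add)
  also have "\<dots> \<le> t * (2 * (exp (2 * u) + exp (-2 * u)))"
  proof (rule mult_left_mono)
    have "0 < exp (2 * u)" "0 < exp (-2 * u)"
      by (rule exp_gt_zero)+
    moreover have "exp (2 * \<bar>u\<bar>) = exp (2 * u) \<or> exp (2 * \<bar>u\<bar>) = exp (-2 * u)"
      by (cases "u \<ge> 0") auto
    moreover have "c \<le> 2 * (a + b)" if "0 < a" "0 < b" "c = a \<or> c = b" for a b c :: real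
      using that by auto
    ultimately show "exp (2 * \<bar>u\<bar>) \<le> 2 * (exp (2 * u) + exp (-2 * u))"
      by blast
  qed (use t in simp)
  finally show ?thesis .
qed

text \<open>By continuity the transform is also nonnegative at \<open>s = 0\<close>, so its value
  there is 0 and a minimum; the derivative at a minimum vanishes.\<close>

lemma mgf_nonneg_imp_critical:
  fixes W h :: "'a \<Rightarrow> real"
  assumes h[measurable]: "h \<in> borel_measurable M"
    and int: "\<And>s. integrable M (\<lambda>x. W x * exp (s * h x))"
    and nonneg: "\<And>s. s \<noteq> 0 \<Longrightarrow> 0 \<le> (LINT x|M. W x * exp (s * h x))"
    and nonpos: "(LINT x|M. W x) \<le> 0"
  shows "(LINT x|M. W x) = 0" "(LINT x|M. W x * h x) = 0"
proof -
  have intW: "integrable M W" and [measurable]: "W \<in> borel_measurable M"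
    using int[of 0] borel_measurable_integrable[OF int[of 0]] by simp_all
  let ?w = "\<lambda>x. \<bar>W x * exp (1 * h x)\<bar> + \<bar>W x * exp (-1 * h x)\<bar>"
  have w: "integrable M ?w"
    by (intro Bochner_Integration.integrable_add integrable_abs int)
  have exp_le: "exp (s * u) \<le> exp u + exp (- u)" if "\<bar>s\<bar> \<le> 1" for s u :: real
  proof -
    have "s * u \<le> \<bar>u\<bar>"
      using mult_right_mono[OF that, of "\<bar>u\<bar>"] abs_ge_self[of "s * u"] by (simp add: abs_mult)
    then have "exp (s * u) \<le> exp \<bar>u\<bar>" by simp
    also have "\<dots> \<le> exp u + exp (- u)" by (simp add: abs_if)
    finally show ?thesis .
  qed
  define t where "t n = inverse (real (Suc n))" for n
  have t: "0 < t n" "t n \<le> 1" "\<bar>t n\<bar> \<le> 1" for n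
    by (auto simp: t_def field_simps)
  have t0: "t \<longlonglongrightarrow> 0"
    unfolding t_def by (rule LIMSEQ_inverse_real_of_nat)
  have "(\<lambda>n. LINT x|M. W x * exp (t n * h x)) \<longlonglongrightarrow> (LINT x|M. W x)"
  proof (rule integral_dominated_convergence[where w = ?w])
    show "AE x in M. (\<lambda>n. W x * exp (t n * h x)) \<longlonglongrightarrow> W x"
      by (rule AE_I2) (auto intro!: tendsto_eq_intros t0)
    show "AE x in M. norm (W x * exp (t n * h x)) \<le> ?w x" for n
    proof (rule AE_I2)
      fix x
      have "\<bar>W x\<bar> * exp (t n * h x) \<le> \<bar>W x\<bar> * (exp (h x) + exp (- h x))"
        by (intro mult_left_mono exp_le t) auto
      then show "norm (W x * exp (t n * h x)) \<le> ?w x"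
        by (simp add: abs_mult algebra_simps)
    qed
  qed (use w in measurable)
  then have "0 \<le> (LINT x|M. W x)"
    by (rule LIMSEQ_le_const) (use nonneg t in \<open>auto simp: less_imp_neq[symmetric]\<close>)
  with nonpos show W0: "(LINT x|M. W x) = 0" by simp
  \<comment> \<open>The right derivative at 0, as a limit of nonnegative quotients. It is taken for
    \<open>k = h\<close> and for \<open>k = - h\<close>, which bounds the derivative from both
    sides.\<close>
  have der: "0 \<le> (LINT x|M. W x * k x)"
    if [measurable]: "k \<in> borel_measurable M"
      and k: "\<And>s. integrable M (\<lambda>x. W x * exp (s * k x))"
        "\<And>s. s \<noteq> 0 \<Longrightarrow> 0 \<le> (LINT x|M. W x * exp (s * k x))" for k
  proof -
    let ?w2 = "\<lambda>x. 2 * (\<bar>W x * exp (2 * k x)\<bar> + \<bar>W x * exp (-2 * k x)\<bar>)"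
    have w2: "integrable M ?w2"
      by (intro Bochner_Integration.integrable_add integrable_abs integrable_mult_right k)
    have "(\<lambda>n. LINT x|M. W x * ((exp (t n * k x) - 1) / t n)) \<longlonglongrightarrow> (LINT x|M. W x * k x)"
    proof (rule integral_dominated_convergence[where w = ?w2])
      show "AE x in M. (\<lambda>n. W x * ((exp (t n * k x) - 1) / t n)) \<longlonglongrightarrow> W x * k x"
      proof (rule AE_I2)
        fix x
        have "((\<lambda>s. exp (s * k x)) has_real_derivative k x) (at 0)"
          by (auto intro!: derivative_eq_intros)
        then have "((\<lambda>s. (exp (s * k x) - 1) / s) \<longlongrightarrow> k x) (at 0)"
          by (simp add: has_field_derivative_iff)
        moreover have "filterlim t (at 0) sequentially"
          using t0 t(1) by (auto simp: filterlim_at less_imp_neq[symmetric])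
        ultimately have "(\<lambda>n. (exp (t n * k x) - 1) / t n) \<longlonglongrightarrow> k x"
          by (rule filterlim_compose)
        then show "(\<lambda>n. W x * ((exp (t n * k x) - 1) / t n)) \<longlonglongrightarrow> W x * k x"
          by (rule tendsto_mult_left)
      qed
      show "AE x in M. norm (W x * ((exp (t n * k x) - 1) / t n)) \<le> ?w2 x" for n
      proof (rule AE_I2)
        fix x
        have "\<bar>exp (t n * k x) - 1\<bar> \<le> t n * (2 * (exp (2 * k x) + exp (-2 * k x)))"
          by (rule abs_exp_minus_one_le) (use t in \<open>auto intro: less_imp_le\<close>)
        then have "\<bar>(exp (t n * k x) - 1) / t n\<bar> \<le> 2 * (exp (2 * k x) + exp (-2 * k x))"
          using t(1)[of n] by (simp add: field_simps abs_divide)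
        then have le: "\<bar>W x\<bar> * \<bar>(exp (t n * k x) - 1) / t n\<bar> \<le> \<bar>W x\<bar> * (2 * (exp (2 * k x) + exp (-2 * k x)))"
          by (rule mult_left_mono) simp
        have "norm (W x * ((exp (t n * k x) - 1) / t n)) = \<bar>W x\<bar> * \<bar>(exp (t n * k x) - 1) / t n\<bar>"
          unfolding real_norm_def by (rule abs_mult)
        moreover have "\<bar>W x\<bar> * (2 * (exp (2 * k x) + exp (-2 * k x))) = ?w2 x"
          by (simp add: abs_mult distrib_left mult_ac)
        ultimately show "norm (W x * ((exp (t n * k x) - 1) / t n)) \<le> ?w2 x"
          using le by linarith
      qed
    qed (use w2 in measurable)
    moreover have "0 \<le> (LINT x|M. W x * ((exp (t n * k x) - 1) / t n))" for n
    proof -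
      have "(LINT x|M. W x * ((exp (t n * k x) - 1) / t n)) = (LINT x|M. (W x * exp (t n * k x) - W x) / t n)"
        by (intro Bochner_Integration.integral_cong refl) (simp add: algebra_simps)
      also have "\<dots> = ((LINT x|M. W x * exp (t n * k x)) - (LINT x|M. W x)) / t n"
        by (simp add: Bochner_Integration.integral_diff[OF k(1) intW])
      finally show ?thesis
        using k(2)[of "t n"] W0 t(1)[of n] by simp
    qed
    ultimately show ?thesis
      by (intro LIMSEQ_le_const) auto
  qed
  have "0 \<le> (LINT x|M. W x * - h x)"
  proof (rule der)
    show "integrable M (\<lambda>x. W x * exp (s * - h x))" for s
      using int[of "- s"] by simp
    show "0 \<le> (LINT x|M. W x * exp (s * - h x))" if "s \<noteq> 0" for s
      using nonneg[of "- s"] that by simp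
  qed measurable
  moreover have "0 \<le> (LINT x|M. W x * h x)"
    by (rule der) (use h int nonneg in auto)
  ultimately show "(LINT x|M. W x * h x) = 0"
    by simp
qed

section \<open>Chords of the exponential function and the sign argument\<close>

text \<open>The tangent at \<open>u\<close> lies strictly below \<open>exp\<close> at
  \<open>a\<close> and at \<open>b\<close>; the average of these two inequalities with weights
  \<open>b - u\<close> and \<open>u - a\<close> eliminates the slope. The form without division
  permits permuting the three points.\<close>

lemma exp_less_chord:
  fixes a b u :: real
  assumes "a < u" "u < b"
  shows "(b - a) * exp u < (b - u) * exp a + (u - a) * exp b"
proof -
  have strict: "exp u * (1 + (v - u)) < exp v" if "v \<noteq> u" for v :: real
  proof -
    have "exp u * (1 + (v - u)) < exp u * exp (v - u)"
      using exp_minus_greater[of "u - v"] that by simp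
    then show ?thesis by (simp flip: exp_add)
  qed
  have "(b - u) * (exp u * (1 + (a - u))) < (b - u) * exp a"
    "(u - a) * (exp u * (1 + (b - u))) < (u - a) * exp b"
    using assms strict[of a] strict[of b] by (simp_all del: mult_less_cancel_left_pos add: mult_strict_left_mono)
  then show ?thesis
    by (simp add: algebra_simps)
qed

text \<open>The affine function is the chord through the points over \<open>a\<close> and
  \<open>b\<close>, or the tangent when they coincide.\<close>

lemma exp_chord_exists:
  fixes a b :: real
  assumes "a \<le> b"
  obtains c d where "\<And>u. a < u \<Longrightarrow> u < b \<Longrightarrow> exp u < c + d * u"
    "\<And>u. u < a \<or> b < u \<Longrightarrow> c + d * u < exp u"
proof (cases "a = b")
  case True
  have "exp a * (1 + (u - a)) < exp u" if "u \<noteq> a" for u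
  proof -
    have "exp a * (1 + (u - a)) < exp a * exp (u - a)"
      using exp_minus_greater[of "a - u"] that by simp
    then show ?thesis by (simp flip: exp_add)
  qed
  then show ?thesis
    using True by (intro that[of "exp a * (1 - a)" "exp a"]) (auto simp: algebra_simps)
next
  case False
  with assms have ab: "0 < b - a" by simp
  define d where "d = (exp b - exp a) / (b - a)"
  define c where "c = exp a - d * a"
  have eq: "(b - a) * (c + d * u) = (b - u) * exp a + (u - a) * exp b" for u
  proof -
    have "(b - a) * d = exp b - exp a" using ab by (simp add: d_def)
    moreover have "(b - a) * (c + d * u) = (b - a) * exp a + ((b - a) * d) * (u - a)"
      by (simp add: c_def algebra_simps)
    ultimately have "(b - a) * (c + d * u) = (b - a) * exp a + (exp b - exp a) * (u - a)"
      by simp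
    then show ?thesis by (simp add: algebra_simps)
  qed
  show ?thesis
  proof (rule that[of c d])
    fix u assume "a < u" "u < b"
    then have "(b - a) * exp u < (b - a) * (c + d * u)"
      unfolding eq by (rule exp_less_chord)
    then show "exp u < c + d * u" using ab by simp
  next
    fix u assume "u < a \<or> b < u"
    then have "(b - a) * (c + d * u) < (b - a) * exp u"
    proof
      assume "u < a"
      \<comment> \<open>The same inequality for the chord from \<open>u\<close> to \<open>b\<close>,
        evaluated at the intermediate point \<open>a\<close>; the next case uses the chord from
        \<open>a\<close> to \<open>u\<close> at \<open>b\<close>.\<close>
      from exp_less_chord[OF this, of b] ab show ?thesis
        unfolding eq by (simp add: algebra_simps)
    next
      assume "b < u"
      from exp_less_chord[OF _ this, of a] ab show ?thesis
        unfolding eq by (simp add: algebra_simps)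
    qed
    then show "c + d * u < exp u" using ab by simp
  qed
qed

text \<open>The vector \<open>p\<close> provides the parameter \<open>x \<bullet> p\<close> along
  \<open>g\<close>. The functions \<open>?F1\<close> and \<open>?F2\<close> are \<open>F\<close>
  times this parameter and times its exponential. Vanishing line integrals of \<open>F\<close> and
  \<open>?F1\<close> allow any affine function of the parameter to be added to the exponential at no
  cost; the chord over the sign interval is the one that makes the integrand of one sign.\<close>

lemma laplace_sign_imp_AE_zero:
  fixes F :: "'a::ordered_euclidean_space \<Rightarrow> real"
  assumes gp: "g \<bullet> p = 1" and F: "all_exp_integrable F"
    and nonpos: "\<And>v. g \<bullet> v = 0 \<Longrightarrow> (LINT x|lborel. F x * exp (x \<bullet> v)) \<le> 0"
    and nonneg: "\<And>v. g \<bullet> v \<noteq> 0 \<Longrightarrow> 0 \<le> (LINT x|lborel. F x * exp (x \<bullet> v))"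
    and sect: "\<And>x. \<exists>a b. a \<le> b \<and> (\<forall>r. a < r \<and> r < b \<longrightarrow> 0 \<le> F (x + r *\<^sub>R g)) \<and>
        (\<forall>r. r < a \<or> b < r \<longrightarrow> F (x + r *\<^sub>R g) \<le> 0)"
  shows "AE x in lborel. F x = 0"
proof -
  let ?F1 = "\<lambda>x. F x * (x \<bullet> p)" and ?F2 = "\<lambda>x. F x * exp (x \<bullet> p)"
  have F1: "all_exp_integrable ?F1" and F2: "all_exp_integrable ?F2"
    using F by (rule all_exp_integrable_mult_inner, rule all_exp_integrable_mult_exp)
  \<comment> \<open>Moving from a point of the hyperplane in direction \<open>p\<close> leaves the
    hyperplane at once, so the transform restricted to that line has its minimum 0 at
    \<open>s = 0\<close>.\<close>
  have crit: "(LINT x|lborel. F x * exp (x \<bullet> v)) = 0 \<and> (LINT x|lborel. ?F1 x * exp (x \<bullet> v)) = 0"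
    if v: "g \<bullet> v = 0" for v
  proof -
    let ?W = "\<lambda>x. F x * exp (x \<bullet> v)"
    have eq: "?W x * exp (s * (x \<bullet> p)) = F x * exp (x \<bullet> (v + s *\<^sub>R p))" for x s
      by (simp add: inner_add_right exp_add mult.assoc)
    have "integrable lborel (\<lambda>x. ?W x * exp (s * (x \<bullet> p)))" for s
      unfolding eq by (rule all_exp_integrableD(1)[OF F])
    moreover have "0 \<le> (LINT x|lborel. ?W x * exp (s * (x \<bullet> p)))" if "s \<noteq> 0" for s
      unfolding eq using that by (intro nonneg) (simp add: inner_add_right v gp)
    ultimately have "(LINT x|lborel. ?W x) = 0" "(LINT x|lborel. ?W x * (x \<bullet> p)) = 0"
      by (intro mgf_nonneg_imp_critical[where h = "\<lambda>x. x \<bullet> p"] nonpos[OF v]; simp)+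
    then show ?thesis
      by (simp add: mult_ac)
  qed
  have "AE x in lborel. line_integral g F x = 0" "AE x in lborel. line_integral g ?F1 x = 0"
    using crit by (auto intro!: laplace_zero_imp_line_integral_zero[OF gp] F F1)
  moreover have "AE x in lborel. integrable lborel (\<lambda>r. F (x + r *\<^sub>R g))"
    "AE x in lborel. integrable lborel (\<lambda>r. ?F1 (x + r *\<^sub>R g))"
    "AE x in lborel. integrable lborel (\<lambda>r. ?F2 (x + r *\<^sub>R g))"
    by (rule AE_integrable_line[OF gp]; rule F F1 F2)+
  ultimately have lines: "AE x in lborel. line_integral g ?F2 x \<le> 0 \<and>
      (line_integral g ?F2 x = 0 \<longrightarrow> (AE r in lborel. F (x + r *\<^sub>R g) = 0))"
  proof eventually_elim
    case (elim x)
    obtain a b where ab: "a \<le> b" "\<And>r. a < r \<Longrightarrow> r < b \<Longrightarrow> 0 \<le> F (x + r *\<^sub>R g)"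
      "\<And>r. r < a \<or> b < r \<Longrightarrow> F (x + r *\<^sub>R g) \<le> 0"
      using sect[of x] by blast
    obtain c d where cd: "\<And>u. a + x \<bullet> p < u \<Longrightarrow> u < b + x \<bullet> p \<Longrightarrow> exp u < c + d * u"
      "\<And>u. u < a + x \<bullet> p \<or> b + x \<bullet> p < u \<Longrightarrow> c + d * u < exp u"
      using exp_chord_exists[of "a + x \<bullet> p" "b + x \<bullet> p"] ab(1) by auto
    \<comment> \<open>Chord minus exponential in the parameter \<open>r + x \<bullet> p\<close> of
      the line: positive inside the interval and negative outside, like \<open>F\<close> in the weak
      sense, so that their product \<open>D\<close> is nonnegative.\<close>
    define k where "k r = c + d * (r + x \<bullet> p) - exp (r + x \<bullet> p)" for r
    define D where "D r = F (x + r *\<^sub>R g) * k r" for r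
    have u: "(x + r *\<^sub>R g) \<bullet> p = r + x \<bullet> p" for r
      by (simp add: inner_add_left gp)
    have D_eq: "D r = c * F (x + r *\<^sub>R g) + d * ?F1 (x + r *\<^sub>R g) - ?F2 (x + r *\<^sub>R g)" for r
      unfolding D_def k_def u by (simp add: algebra_simps)
    have intD: "integrable lborel D"
      unfolding D_eq[abs_def] using elim
      by (intro Bochner_Integration.integrable_diff Bochner_Integration.integrable_add integrable_mult_right)
    have "(LINT r|lborel. D r) = c * line_integral g F x + d * line_integral g ?F1 x - line_integral g ?F2 x"
      unfolding D_eq line_integral_def using elim
      by (simp add: Bochner_Integration.integral_diff Bochner_Integration.integral_add)
    also have "\<dots> = - line_integral g ?F2 x"
      using elim by simp
    finally have LD: "(LINT r|lborel. D r) = - line_integral g ?F2 x" .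
    \<comment> \<open>The sign of \<open>F\<close> is unknown at the two ends, which form a null
      set.\<close>
    have ne: "AE r in lborel. r \<noteq> a \<and> r \<noteq> b"
      using AE_lborel_singleton[of a] AE_lborel_singleton[of b] by eventually_elim simp
    have sgn: "0 \<le> D r" "k r \<noteq> 0" if r: "r \<noteq> a \<and> r \<noteq> b" for r
    proof -
      consider "a < r \<and> r < b" | "r < a \<or> b < r"
        using r by linarith
      then have "0 \<le> D r \<and> k r \<noteq> 0"
      proof cases
        case 1
        then show ?thesis
          using ab(2)[of r] cd(1)[of "r + x \<bullet> p"] by (simp add: D_def k_def)
      next
        case 2
        then show ?thesis
          using ab(3)[of r] cd(2)[of "r + x \<bullet> p"] by (auto simp: D_def k_def intro: mult_nonpos_nonpos)
      qed
      then show "0 \<le> D r" "k r \<noteq> 0" by auto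
    qed
    have D0: "AE r in lborel. 0 \<le> D r"
      using ne by eventually_elim (rule sgn)
    have "AE r in lborel. F (x + r *\<^sub>R g) = 0" if "line_integral g ?F2 x = 0"
    proof -
      have "AE r in lborel. D r = 0"
        using integral_nonneg_eq_0_iff_AE[OF intD D0] LD that by simp
      then show ?thesis
        using ne by eventually_elim (use sgn(2) in \<open>auto simp: D_def\<close>)
    qed
    then show ?case
      using integral_nonneg_AE[OF D0] LD by auto
  qed
  have "AE x in lborel. line_integral g ?F2 x = 0"
  proof (rule line_integral_nonpos_imp_zero[OF gp F2])
    show "AE x in lborel. line_integral g ?F2 x \<le> 0"
      using lines by eventually_elim simp
    \<comment> \<open>This is the transform of \<open>F\<close> at \<open>p\<close>, which lies off
      the hyperplane.\<close>
    show "0 \<le> (LINT x|lborel. ?F2 x)"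
      by (rule nonneg) (simp add: gp)
  qed
  with lines have "AE x in lborel. AE r in lborel. F (x + r *\<^sub>R g) = 0"
    by eventually_elim simp
  then show ?thesis
    by (rule line_AE_zero_imp_AE_zero[OF gp F])
qed

section \<open>Positive definite matrices\<close>

lemma pos_def_symmetric:
  assumes "pos_def S"
  shows "S $ i $ j = S $ j $ i"
proof -
  have "S $ i $ j = transpose S $ j $ i"
    by (simp add: transpose_def)
  then show ?thesis
    using assms by (simp add: pos_def_def)
qed

lemma pos_def_invertible:
  assumes "pos_def S"
  shows "matrix_inv S ** S = mat 1" "S ** matrix_inv S = mat 1"
proof -
  have "x = 0" if "S *v x = 0" for x
    using assms that unfolding pos_def_def by (metis inner_zero_right less_irrefl)
  then have "invertible S"
    using matrix_left_invertible_ker[of S] invertible_left_inverse[of S] by blast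
  then show "matrix_inv S ** S = mat 1" "S ** matrix_inv S = mat 1"
    using someI_ex[of "\<lambda>Q. S ** Q = mat 1 \<and> Q ** S = mat 1"]
    unfolding invertible_def matrix_inv_def by auto
qed

lemma pos_def_inner_commute:
  assumes "pos_def S"
  shows "x \<bullet> (S *v y) = y \<bullet> (S *v x)"
proof -
  have "x \<bullet> (S *v y) = (x v* S) \<bullet> y"
    by (rule dot_lmul_matrix[symmetric])
  also have "x v* S = S *v x"
    using assms by (metis pos_def_def transpose_matrix_vector)
  finally show ?thesis
    by (simp add: inner_commute)
qed

lemma pos_def_matrix_inv:
  assumes S: "pos_def S"
  shows "pos_def (matrix_inv S)"
  unfolding pos_def_def
proof (intro conjI allI impI)
  let ?P = "matrix_inv S"
  have SP: "S *v (?P *v x) = x" "?P *v (S *v x) = x" for x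
    using pos_def_invertible[OF S] by (simp_all add: matrix_vector_mul_assoc)
  have "transpose ?P = transpose ?P ** (S ** ?P)"
    by (simp add: pos_def_invertible[OF S])
  also have "\<dots> = transpose (S ** ?P) ** ?P"
    using S by (simp add: matrix_transpose_mul matrix_mul_assoc pos_def_def)
  also have "\<dots> = ?P"
    by (simp add: pos_def_invertible[OF S])
  finally show "transpose ?P = ?P" .
  fix x :: "real^'a" assume "x \<noteq> 0"
  then have "?P *v x \<noteq> 0"
    using SP(1)[of x] by auto
  then have "0 < (?P *v x) \<bullet> (S *v (?P *v x))"
    using S by (simp add: pos_def_def)
  then show "0 < x \<bullet> (?P *v x)"
    by (simp add: SP inner_commute)
qed

text \<open>The constant is the minimum of the quadratic form on the compact unit sphere;
  homogeneity extends the bound.\<close>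

lemma pos_def_lower_bound:
  assumes S: "pos_def (S :: real^'n^'n)"
  obtains \<kappa> where "0 < \<kappa>" "\<And>x. \<kappa> * (norm x)\<^sup>2 \<le> x \<bullet> (S *v x)"
proof -
  let ?q = "\<lambda>x. x \<bullet> (S *v x)"
  have "axis undefined 1 \<in> sphere (0 :: real^'n) 1"
    by simp
  moreover have "continuous_on (sphere 0 1) ?q"
    by (intro continuous_intros)
  ultimately obtain m where m: "m \<in> sphere 0 1" "\<And>x. x \<in> sphere 0 1 \<Longrightarrow> ?q m \<le> ?q x"
    using continuous_attains_inf[of "sphere 0 1" ?q] by (metis compact_sphere empty_iff)
  show ?thesis
  proof (rule that[of "?q m"])
    have "m \<noteq> 0" using m(1) by auto
    then show "0 < ?q m" using S by (simp add: pos_def_def)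
    fix x :: "real^'n"
    show "?q m * (norm x)\<^sup>2 \<le> ?q x"
    proof (cases "x = 0")
      case False
      then have "x /\<^sub>R norm x \<in> sphere 0 1"
        by simp
      from m(2)[OF this] have "?q m \<le> ?q x / (norm x)\<^sup>2"
        by (simp add: matrix_vector_mult_scaleR power2_eq_square field_simps)
      then show ?thesis
        using False by (simp add: field_simps)
    qed simp
  qed
qed

text \<open>All matrices on the segment from the identity to \<open>S\<close> are positive definite,
  hence nonsingular, so the determinant cannot change sign on the way from its value 1 at the
  identity.\<close>

lemma pos_def_det_pos:
  assumes S: "pos_def (S :: real^'n^'n)"
  shows "0 < det S"
proof (rule ccontr)
  assume neg: "\<not> 0 < det S"
  define A where "A t = (1 - t) *\<^sub>R mat 1 + t *\<^sub>R S" for t :: real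
  have "continuous_on {0..1} (\<lambda>t. det (A t))"
    unfolding det_def A_def by (auto intro!: continuous_intros)
  then obtain t where t: "0 \<le> t" "t \<le> 1" "det (A t) = 0"
    using IVT2'[of "\<lambda>t. det (A t)" 1 0 0] neg by (auto simp: A_def)
  then obtain x where x: "x \<noteq> 0" "A t *v x = 0"
    using invertible_det_nz[of "A t"] matrix_left_invertible_ker[of "A t"]
      invertible_left_inverse[of "A t"] by blast
  have "(1 - t) * (x \<bullet> x) + t * (x \<bullet> (S *v x)) = x \<bullet> (A t *v x)"
    by (simp add: A_def matrix_vector_mult_add_rdistrib scaleR_matrix_vector_assoc[symmetric] inner_add_right)
  also have "\<dots> = 0"
    using x by simp
  finally have 0: "(1 - t) * (x \<bullet> x) + t * (x \<bullet> (S *v x)) = 0" .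
  have "0 < x \<bullet> x" "0 < x \<bullet> (S *v x)"
    using S x by (auto simp: pos_def_def)
  moreover from this have "0 \<le> (1 - t) * (x \<bullet> x)" "0 \<le> t * (x \<bullet> (S *v x))"
    using t by auto
  ultimately show False
    using 0 by (cases "t = 0") (auto simp: add_nonneg_eq_0_iff)
qed

section \<open>Acceptance regions of the MRD procedure\<close>

text \<open>A column of the reduced matrix is that matrix applied to a basis vector, which the
  inverse gives back. Statistically, the best linear prediction of a retained variable is that
  variable itself.\<close>

lemma del_vec_column_insert:
  fixes S :: "real^'n^'n"
  assumes S: "pos_def S" and i: "i \<notin> D"
  shows "del_inv D S *v del_vec D (column i S) = axis i 1"
proof -
  have "del_vec D (column i S) = del_mat D S *v axis i 1"
    unfolding matrix_vector_mult_basis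
    using i by (auto simp: vec_eq_iff del_vec_def del_mat_def column_def)
  then have "del_inv D S *v del_vec D (column i S) = del_mat D (mat 1) *v axis i 1"
    using is_del_inv_del_inv[OF S, of D] by (simp add: matrix_vector_mul_assoc is_del_inv_def)
  also have "\<dots> = axis i 1"
    unfolding matrix_vector_mult_basis
    using i by (auto simp: vec_eq_iff del_mat_def mat_def column_def axis_def)
  finally show ?thesis .
qed

lemma mrd_residual_add_scale:
  "mrd_residual S R j (x + r *\<^sub>R y) = mrd_residual S R j x + r * mrd_residual S R j y"
proof -
  have "del_vec D (x + r *\<^sub>R y) = del_vec D x + r *\<^sub>R del_vec D y" for D
    by (auto simp: del_vec_def vec_eq_iff)
  then show ?thesis
    by (simp add: mrd_residual_def matrix_vector_right_distrib matrix_vector_mult_scaleR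
        inner_add_right add_divide_distrib diff_divide_distrib algebra_simps)
qed

text \<open>A linear form evaluated at \<open>column i S\<close> is its covariance with the
  \<open>i\<close>-th variable. For \<open>i\<close> outside \<open>insert j R\<close> this variable
  is one of the predictors, and a regression residual is uncorrelated with its predictors.\<close>

lemma mrd_residual_column_other:
  assumes S: "pos_def S" and "i \<notin> R" "i \<noteq> j"
  shows "mrd_residual S R j (column i S) = 0"
proof -
  have "cov_vec S R j \<bullet> axis i 1 = S $ i $ j"
    using assms by (simp add: inner_axis cov_vec_def del_vec_def column_def)
  then show ?thesis
    using assms del_vec_column_insert[OF S, of i "insert j R"] pos_def_symmetric[OF S, of i j]
    by (simp add: mrd_residual_def column_def)
qed

text \<open>The conditional variance is the quadratic form of \<open>S\<close> at the coefficient
  vector of the unnormalised residual, and this vector is nonzero.\<close>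

lemma cond_var_pos:
  assumes S: "pos_def S"
  shows "0 < cond_var S R i"
proof -
  let ?D = "insert i R"
  let ?B = "del_inv ?D S"
  let ?c = "cov_vec S R i"
  let ?y = "?B *v ?c"
  have B: "del_mat ?D ?B = ?B" "del_mat ?D S ** ?B = del_mat ?D (mat 1)"
    using is_del_inv_del_inv[OF S, of ?D] by (auto simp: is_del_inv_def)
  have yD: "?y $ k = 0" if "k \<in> ?D" for k
  proof -
    have "?B $ k $ l = 0" for l
      using that by (subst B(1)[symmetric]) (auto simp: del_mat_def)
    then show ?thesis
      by (simp add: matrix_vector_mult_def)
  qed
  \<comment> \<open>The normal equations: the prediction with coefficients \<open>?y\<close> has the
    right covariance with each predictor.\<close>
  have Sy: "(S *v ?y) $ k = ?c $ k" if "k \<notin> ?D" for k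
  proof -
    have "(S *v ?y) $ k = (del_mat ?D S *v ?y) $ k"
      unfolding matrix_vector_mult_def[of _ "?y"] vec_lambda_beta
      using that yD by (intro sum.cong) (auto simp: del_mat_def)
    also have "del_mat ?D S *v ?y = del_mat ?D (mat 1) *v ?c"
      by (simp add: matrix_vector_mul_assoc B)
    also have "\<dots> $ k = (\<Sum>l\<in>UNIV. if l = k then ?c $ k else 0)"
      unfolding matrix_vector_mult_def vec_lambda_beta
      using that by (intro sum.cong) (auto simp: del_mat_def mat_def cov_vec_def del_vec_def)
    finally show ?thesis by simp
  qed
  have ySy: "?y \<bullet> (S *v ?y) = ?c \<bullet> ?y"
    unfolding inner_vec_def
    by (rule sum.cong) (use yD Sy in \<open>auto simp: mult.commute\<close>)
  have cy: "axis i 1 \<bullet> (S *v ?y) = ?c \<bullet> ?y"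
  proof -
    have "axis i 1 \<bullet> (S *v ?y) = (\<Sum>k\<in>UNIV. S $ i $ k * ?y $ k)"
      by (simp add: inner_axis' matrix_vector_mult_def)
    also have "\<dots> = (\<Sum>k\<in>UNIV. ?c $ k * ?y $ k)"
      using yD pos_def_symmetric[OF S]
      by (intro sum.cong) (auto simp: cov_vec_def del_vec_def column_def)
    finally show ?thesis
      by (simp add: inner_vec_def)
  qed
  \<comment> \<open>The residual's coefficients; the \<open>i\<close>-th entry is 1 because a
    variable does not predict itself.\<close>
  let ?z = "axis i 1 - ?y"
  have "?z $ i \<noteq> 0"
    using yD[of i] by simp
  then have "?z \<noteq> 0"
    by (metis zero_index)
  then have "0 < ?z \<bullet> (S *v ?z)"
    using S by (simp add: pos_def_def)
  also have "?z \<bullet> (S *v ?z) = axis i 1 \<bullet> (S *v axis i 1) - axis i 1 \<bullet> (S *v ?y)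
      - (?y \<bullet> (S *v axis i 1) - ?y \<bullet> (S *v ?y))"
    by (simp add: matrix_vector_mult_diff_distrib inner_diff_left inner_diff_right)
  also have "\<dots> = S $ i $ i - ?c \<bullet> ?y"
    unfolding pos_def_inner_commute[OF S, of ?y "axis i 1"] ySy cy
    by (simp add: inner_axis' matrix_vector_mult_basis column_def)
  finally show ?thesis
    by (simp add: cond_var_def)
qed

lemma mrd_residual_column_self:
  assumes S: "pos_def S"
  shows "mrd_residual S R i (column i S) = sqrt (cond_var S R i)"
  using cond_var_pos[OF S, of R i]
  by (simp add: mrd_residual_def cond_var_def cov_vec_def column_def real_div_sqrt)

section \<open>Runs of the procedure at points of one line\<close>

text \<open>A finite nonempty set of residuals attains its maximum, so the \<open>LEAST\<close> is
  genuine. The right-hand side separates maximality from the tie-breaking rule and consists of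
  comparisons of residuals only, which also yields measurability.\<close>

lemma mrd_index_eq_iff:
  assumes "R \<noteq> UNIV"
  shows "mrd_index S x R = j \<longleftrightarrow> j \<notin> R \<and>
    (\<forall>k. k \<notin> R \<longrightarrow> \<bar>mrd_residual S R k x\<bar> \<le> \<bar>mrd_residual S R j x\<bar>) \<and>
    (\<forall>k. k \<notin> R \<longrightarrow> \<bar>mrd_residual S R k x\<bar> = \<bar>mrd_residual S R j x\<bar> \<longrightarrow> j \<le> k)"
    (is "_ \<longleftrightarrow> ?rhs j")
proof -
  let ?P = "\<lambda>j. j \<notin> R \<and> (\<forall>k. k \<notin> R \<longrightarrow> \<bar>mrd_residual S R k x\<bar> \<le> \<bar>mrd_residual S R j x\<bar>)"
  let ?V = "(\<lambda>k. \<bar>mrd_residual S R k x\<bar>) ` (- R)"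
  have "?V \<noteq> {}" using assms by auto
  then have "Max ?V \<in> ?V" by (intro Max_in) auto
  then obtain j0 where "j0 \<notin> R" "Max ?V = \<bar>mrd_residual S R j0 x\<bar>" by auto
  then have "?P j0"
    using Max_ge[of ?V] by force
  then have L: "Least ?P = Min {k. ?P k}" and ne: "{k. ?P k} \<noteq> {}"
    by (auto intro!: Least_Min)
  from Min_in[OF _ ne] have "?P (Least ?P)"
    unfolding L by simp
  moreover have "Least ?P \<le> k" if "?P k" for k
    unfolding L using that by (intro Min_le) auto
  ultimately have "?rhs (Least ?P)"
    by auto
  moreover have "j = j'" if "?rhs j" "?rhs j'" for j j'
    using that by (meson order_antisym)
  ultimately show ?thesis
    unfolding mrd_index_def by blast
qed

lemma mrd_reaches_card:
  assumes "mrd_reaches S C x m R"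
  shows "m = Suc (card R)"
  using assms
proof induction
  case (reject m R)
  then have "R \<noteq> UNIV" by auto
  then have "mrd_index S x R \<notin> R"
    using mrd_index_eq_iff[of R S x "mrd_index S x R"] by simp
  then show ?case
    using reject by simp
qed simp

text \<open>The point \<open>y\<close> accepts \<open>i\<close>, so its choice \<open>?K\<close>
  differs from \<open>i\<close> and has the same residual at \<open>x\<close> and at
  \<open>y\<close>. Maximality at both points then forces \<open>?K\<close> and the choice
  \<open>?J\<close> at \<open>x\<close> to tie at each of them, and the tie-breaking rule makes them
  equal. When \<open>?J = i\<close> the conclusion contradicts the acceptance of \<open>i\<close>;
  the caller exploits this.\<close>

lemma mrd_reaches_step:
  fixes x y :: "real^('n::{finite,linorder})"
  assumes y: "mrd_reaches S C y m R" "m \<le> CARD('n)" "\<not> mrd_rejects S C y i"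
    and C: "C m \<le> \<bar>mrd_residual S R (mrd_index S x R) x\<bar>"
    and other: "\<And>j. j \<noteq> i \<Longrightarrow> mrd_residual S R j y = mrd_residual S R j x"
    and self: "mrd_index S x R = i \<Longrightarrow> \<bar>mrd_residual S R i x\<bar> \<le> \<bar>mrd_residual S R i y\<bar>"
  shows "mrd_reaches S C y (Suc m) (insert (mrd_index S x R) R)"
proof -
  let ?J = "mrd_index S x R" and ?K = "mrd_index S y R"
  have R: "R \<noteq> UNIV"
    using mrd_reaches_card[OF y(1)] y(2) by auto
  have iR: "i \<notin> R"
    using y unfolding mrd_rejects_def by blast
  have J: "?J \<notin> R" "\<And>k. k \<notin> R \<Longrightarrow> \<bar>mrd_residual S R k x\<bar> \<le> \<bar>mrd_residual S R ?J x\<bar>"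
    "\<And>k. k \<notin> R \<Longrightarrow> \<bar>mrd_residual S R k x\<bar> = \<bar>mrd_residual S R ?J x\<bar> \<Longrightarrow> ?J \<le> k"
    using mrd_index_eq_iff[OF R, of S x ?J] by auto
  have K: "?K \<notin> R" "\<And>k. k \<notin> R \<Longrightarrow> \<bar>mrd_residual S R k y\<bar> \<le> \<bar>mrd_residual S R ?K y\<bar>"
    "\<And>k. k \<notin> R \<Longrightarrow> \<bar>mrd_residual S R k y\<bar> = \<bar>mrd_residual S R ?K y\<bar> \<Longrightarrow> ?K \<le> k"
    using mrd_index_eq_iff[OF R, of S y ?K] by auto
  have "C m \<le> \<bar>mrd_residual S R ?J y\<bar>"
    using C other self by (cases "?J = i") fastforce+
  then have CK: "C m \<le> \<bar>mrd_residual S R ?K y\<bar>"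
    using K(2)[OF J(1)] by linarith
  have step: "mrd_reaches S C y (Suc m) (insert ?K R)"
    by (rule reject[OF y(1,2) CK])
  then have Ki: "?K \<noteq> i"
    using y(3) unfolding mrd_rejects_def by blast
  have "?K = ?J"
  proof (cases "?J = i")
    case True
    have "\<bar>mrd_residual S R ?K x\<bar> \<le> \<bar>mrd_residual S R i x\<bar>"
      using J(2)[OF K(1)] True by simp
    moreover have "\<bar>mrd_residual S R i y\<bar> \<le> \<bar>mrd_residual S R ?K y\<bar>"
      using K(2)[OF iR] .
    ultimately have eq: "\<bar>mrd_residual S R ?K x\<bar> = \<bar>mrd_residual S R i x\<bar>"
      "\<bar>mrd_residual S R i y\<bar> = \<bar>mrd_residual S R ?K y\<bar>"
      using self[OF True] other[OF Ki] by auto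
    show ?thesis
      using J(3)[OF K(1)] K(3)[OF iR] eq True by (auto intro: order_antisym)
  next
    case False
    have "\<bar>mrd_residual S R ?K x\<bar> = \<bar>mrd_residual S R ?J x\<bar>"
      "\<bar>mrd_residual S R ?J y\<bar> = \<bar>mrd_residual S R ?K y\<bar>"
      using J(2)[OF K(1)] K(2)[OF J(1)] other[OF Ki] other[OF False] by auto
    then show ?thesis
      using J(3)[OF K(1)] K(3)[OF J(1)] by (auto intro: order_antisym)
  qed
  with step show ?thesis
    by simp
qed

lemma abs_affine_le_max:
  fixes u s r t :: real
  assumes "0 \<le> r" "r \<le> t"
  shows "\<bar>u + r * s\<bar> \<le> \<bar>u\<bar> \<or> \<bar>u + r * s\<bar> \<le> \<bar>u + t * s\<bar>"
proof (cases "0 \<le> s")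
  case True
  then have "r * s \<le> t * s" "0 \<le> r * s"
    using assms by (auto intro: mult_right_mono)
  then show ?thesis by linarith
next
  case False
  then have "t * s \<le> r * s" "r * s \<le> 0"
    using assms by (auto intro: mult_right_mono_neg mult_nonneg_nonpos)
  then show ?thesis by linarith
qed

lemma mrd_residual_column_line:
  assumes S: "pos_def S"
  shows "i \<notin> R \<Longrightarrow> j \<noteq> i \<Longrightarrow> mrd_residual S R j (x + r *\<^sub>R column i S) = mrd_residual S R j x"
    "mrd_residual S R i (x + r *\<^sub>R column i S) = mrd_residual S R i x + r * sqrt (cond_var S R i)"
  using mrd_residual_column_other[OF S, of i R j] mrd_residual_column_self[OF S, of R i]
  by (simp_all add: mrd_residual_add_scale)

text \<open>Every state reached from the intermediate point is reached from both ends as well, by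
  induction on the run. A rejection of \<open>i\<close> in between would thus be a rejection at an
  end.\<close>

lemma mrd_accepts_between:
  fixes S :: "real^('n::{finite,linorder})^('n::{finite,linorder})"
  assumes S: "pos_def S" and rt: "0 \<le> r" "r \<le> t"
    and acc: "\<not> mrd_rejects S C x i" "\<not> mrd_rejects S C (x + t *\<^sub>R column i S) i"
  shows "\<not> mrd_rejects S C (x + r *\<^sub>R column i S) i"
proof -
  let ?g = "column i S"
  let ?z = "x + r *\<^sub>R ?g" and ?y = "x + t *\<^sub>R ?g"
  have "mrd_reaches S C x m R \<and> mrd_reaches S C ?y m R" if "mrd_reaches S C ?z m R" for m R
    using that
  proof induction
    case start
    show ?case by (intro conjI mrd_reaches.start)
  next
    case (reject m R)
    then have reach: "mrd_reaches S C x m R" "mrd_reaches S C ?y m R" by auto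
    have iR: "i \<notin> R"
      using reach acc unfolding mrd_rejects_def by blast
    let ?J = "mrd_index S ?z R"
    have step: "mrd_reaches S C w (Suc m) (insert ?J R)"
      if "w = x \<or> w = ?y" "?J = i \<Longrightarrow> \<bar>mrd_residual S R i ?z\<bar> \<le> \<bar>mrd_residual S R i w\<bar>" for w
    proof (rule mrd_reaches_step[where i = i and x = ?z])
      show "mrd_residual S R j w = mrd_residual S R j ?z" if "j \<noteq> i" for j
        using \<open>w = x \<or> w = ?y\<close> mrd_residual_column_line(1)[OF S iR that] by auto
    qed (use that reach acc reject in auto)
    \<comment> \<open>The absolute value of an affine function is convex, so one of the ends has a
      residual of \<open>i\<close> at least as large; that end would reject \<open>i\<close> at this
      stage.\<close>
    have "?J \<noteq> i"
    proof
      assume Ji: "?J = i"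
      have "\<bar>mrd_residual S R i ?z\<bar> \<le> \<bar>mrd_residual S R i x\<bar>
          \<or> \<bar>mrd_residual S R i ?z\<bar> \<le> \<bar>mrd_residual S R i ?y\<bar>"
        unfolding mrd_residual_column_line(2)[OF S] by (rule abs_affine_le_max[OF rt])
      then have "mrd_reaches S C x (Suc m) (insert i R) \<or> mrd_reaches S C ?y (Suc m) (insert i R)"
        using step[of x] step[of ?y] unfolding Ji by blast
      then show False
        using acc unfolding mrd_rejects_def by blast
    qed
    then show ?case
      using step[of x] step[of ?y] by blast
  qed
  then show ?thesis
    using acc unfolding mrd_rejects_def by blast
qed

text \<open>At the first stage only the residual of \<open>i\<close> changes along the line, with
  nonzero slope. Far out it exceeds both the other residuals and \<open>C 1\<close>, so
  \<open>i\<close> is rejected immediately.\<close>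

lemma mrd_rejects_far:
  fixes S :: "real^('n::{finite,linorder})^('n::{finite,linorder})"
  assumes S: "pos_def S"
  obtains B where "\<And>r. B < \<bar>r\<bar> \<Longrightarrow> mrd_rejects S C (x + r *\<^sub>R column i S) i"
proof -
  let ?U = "mrd_residual S {}"
  let ?s = "sqrt (cond_var S {} i)"
  let ?K = "\<bar>?U i x\<bar> + (\<Sum>k\<in>UNIV. \<bar>?U k x\<bar>) + \<bar>C 1\<bar>"
  have s: "0 < ?s"
    using cond_var_pos[OF S] by simp
  show ?thesis
  proof (rule that[of "?K / ?s"])
    fix r assume "?K / ?s < \<bar>r\<bar>"
    then have "?K < \<bar>r * ?s\<bar>"
      using s by (simp add: field_simps abs_mult)
    then have big: "(\<Sum>k\<in>UNIV. \<bar>?U k x\<bar>) + \<bar>C 1\<bar> < \<bar>?U i (x + r *\<^sub>R column i S)\<bar>"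
      unfolding mrd_residual_column_line(2)[OF S] by linarith
    have lt: "\<bar>?U k (x + r *\<^sub>R column i S)\<bar> < \<bar>?U i (x + r *\<^sub>R column i S)\<bar>" if "k \<noteq> i" for k
    proof -
      have "\<bar>?U k x\<bar> \<le> (\<Sum>k\<in>UNIV. \<bar>?U k x\<bar>)"
        by (rule member_le_sum) auto
      then show ?thesis
        using big mrd_residual_column_line(1)[OF S _ that, of "{}" x r] by simp
    qed
    have "mrd_index S (x + r *\<^sub>R column i S) {} = i"
      by (subst mrd_index_eq_iff) (use lt in \<open>force simp: order_le_less\<close>)+
    moreover have "C 1 \<le> \<bar>?U i (x + r *\<^sub>R column i S)\<bar>"
      using big sum_nonneg[of UNIV "\<lambda>k. \<bar>?U k x\<bar>"] abs_ge_self[of "C 1"] abs_ge_zero by linarith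
    ultimately have "mrd_reaches S C (x + r *\<^sub>R column i S) (Suc 1) (insert i {})"
      using reject[OF start[of S C "x + r *\<^sub>R column i S"]] by (simp add: Suc_le_eq)
    then show "mrd_rejects S C (x + r *\<^sub>R column i S) i"
      unfolding mrd_rejects_def by blast
  qed
qed

text \<open>The acceptance set on the line is order-convex and bounded, so its infimum and supremum
  serve as ends. If it is empty, any degenerate interval will do.\<close>

lemma mrd_section_interval:
  fixes S :: "real^('n::{finite,linorder})^('n::{finite,linorder})"
  assumes S: "pos_def S"
  obtains a b where "a \<le> b"
    "\<And>r. a < r \<Longrightarrow> r < b \<Longrightarrow> \<not> mrd_rejects S C (x + r *\<^sub>R column i S) i"
    "\<And>r. r < a \<or> b < r \<Longrightarrow> mrd_rejects S C (x + r *\<^sub>R column i S) i"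
proof -
  define A where "A = {r. \<not> mrd_rejects S C (x + r *\<^sub>R column i S) i}"
  obtain B where B: "\<And>r. B < \<bar>r\<bar> \<Longrightarrow> r \<notin> A"
    unfolding A_def using mrd_rejects_far[OF S] by (metis mem_Collect_eq)
  have bdd: "bdd_above A" "bdd_below A"
    using B by (force intro: bdd_aboveI[of _ B] bdd_belowI[of _ "- B"])+
  have conv: "r \<in> A" if "u \<in> A" "v \<in> A" "u \<le> r" "r \<le> v" for u v r
    using mrd_accepts_between[OF S, of "r - u" "v - u" C "x + u *\<^sub>R column i S" i] that
    by (simp add: A_def add.assoc flip: scaleR_add_left)
  show ?thesis
  proof (cases "A = {}")
    case True
    then show ?thesis
      by (intro that[of 0 0]) (auto simp: A_def)
  next
    case False
    show ?thesis
    proof (rule that[of "Inf A" "Sup A"])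
      show "Inf A \<le> Sup A"
        using False bdd by (rule cInf_le_cSup)
      fix r
      show "\<not> mrd_rejects S C (x + r *\<^sub>R column i S) i" if "Inf A < r" "r < Sup A"
      proof -
        obtain u v where "u \<in> A" "u < r" "v \<in> A" "r < v"
          using \<open>Inf A < r\<close> \<open>r < Sup A\<close> cInf_less_iff[OF False bdd(2)] less_cSup_iff[OF False bdd(1)]
          by blast
        then have "r \<in> A"
          using conv[of u v r] by simp
        then show ?thesis
          by (simp add: A_def)
      qed
      show "mrd_rejects S C (x + r *\<^sub>R column i S) i" if "r < Inf A \<or> Sup A < r"
        using that cInf_lower[OF _ bdd(2)] cSup_upper[OF _ bdd(1)] by (force simp: A_def)
    qed
  qed
qed

section \<open>Measurability of the induced tests\<close>

lemma mrd_residual_measurable [measurable]: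
  "mrd_residual S R j \<in> borel_measurable borel"
proof (rule borel_measurable_continuous_onI, rule linear_continuous_on, rule linear_conv_bounded_linear[THEN iffD1])
  show "linear (mrd_residual S R j)"
  proof (rule linearI)
    show "mrd_residual S R j (x + y) = mrd_residual S R j x + mrd_residual S R j y" for x y
      using mrd_residual_add_scale[of S R j x 1 y] by simp
    have "mrd_residual S R j 0 = 0"
      using mrd_residual_add_scale[of S R j 0 1 0] by simp
    then show "mrd_residual S R j (c *\<^sub>R x) = c *\<^sub>R mrd_residual S R j x" for c x
      using mrd_residual_add_scale[of S R j 0 c x] by simp
  qed
qed

lemma mrd_index_measurable [measurable]:
  "Measurable.pred borel (\<lambda>x. mrd_index S x R = j)"
proof (cases "R = UNIV")
  case True
  then show ?thesis
    by (simp add: mrd_index_def)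
next
  case False
  show ?thesis
    unfolding mrd_index_eq_iff[OF False] by measurable
qed

lemma mrd_reaches_measurable [measurable]:
  fixes S :: "real^('n::{finite,linorder})^('n::{finite,linorder})"
  shows "Measurable.pred borel (\<lambda>x. mrd_reaches S C x m R)"
proof (induction m arbitrary: R)
  case 0
  have "\<not> mrd_reaches S C x 0 R" for x
    using mrd_reaches_card[of S C x 0 R] by auto
  then show ?case by simp
next
  case (Suc m)
  note Suc.IH[measurable]
  \<comment> \<open>The last step of a run, written as a finite disjunction over the preceding set
    and the index added. The first disjunct is the start, since stages count from 1.\<close>
  have "mrd_reaches S C x (Suc m) R \<longleftrightarrow> (m = 0 \<and> R = {}) \<or>
    (\<exists>R'\<in>UNIV. \<exists>j\<in>UNIV. R = insert j R' \<and> m \<le> CARD('n) \<and> mrd_reaches S C x m R' \<and>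
       mrd_index S x R' = j \<and> C m \<le> \<bar>mrd_residual S R' j x\<bar>)" for x
    by (subst mrd_reaches.simps) auto
  moreover have "Measurable.pred borel (\<lambda>x. R = insert j R' \<and> m \<le> CARD('n) \<and>
      mrd_reaches S C x m R' \<and> mrd_index S x R' = j \<and> C m \<le> \<bar>mrd_residual S R' j x\<bar>)" for R' j
    by measurable
  ultimately show ?case
    by (simp only:) (intro pred_intros_logic(5) pred_intros_finite(4) finite_UNIV, simp_all)
qed

lemma is_test_mrd_test: "is_test (mrd_test S C i)"
proof -
  have [measurable]: "Measurable.pred borel (\<lambda>x. mrd_rejects S C x i)"
  proof -
    have "mrd_rejects S C x i \<longleftrightarrow> (\<exists>m. \<exists>R\<in>UNIV. mrd_reaches S C x m R \<and> i \<in> R)" for x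
      by (auto simp: mrd_rejects_def)
    then show ?thesis by simp
  qed
  show ?thesis
    unfolding is_test_def mrd_test_def by simp
qed

section \<open>Admissibility\<close>

lemma all_exp_integrable_pos_def:
  assumes P: "pos_def (P :: real^'n^'n)"
  shows "all_exp_integrable (\<lambda>x. exp (- (x \<bullet> (P *v x)) / 2))"
proof -
  obtain \<kappa> where \<kappa>: "0 < \<kappa>" "\<And>x. \<kappa> * (norm x)\<^sup>2 \<le> x \<bullet> (P *v x)"
    using pos_def_lower_bound[OF P] by blast
  show ?thesis
  proof (rule all_exp_integrable_bound[OF all_exp_integrable_gaussian[of "\<kappa> / 2"]])
    show "\<bar>exp (- (x \<bullet> (P *v x)) / 2)\<bar> \<le> \<bar>exp (- (\<kappa> / 2) * (norm x)\<^sup>2)\<bar>" for x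
      using \<kappa>(2)[of x] by simp
    show "(\<lambda>x. exp (- (x \<bullet> (P *v x)) / 2)) \<in> borel_measurable borel"
      by (intro borel_measurable_continuous_onI continuous_intros) simp
  qed (use \<kappa> in simp)
qed

text \<open>Expanding the quadratic form in the density leaves a factor depending on
  \<open>\<mu>\<close> alone. As \<open>k\<close> is the same for all tests, the powers of two tests
  at \<open>\<mu>\<close> compare like their transforms.\<close>

lemma power_fun_eq_laplace:
  fixes S :: "real^'n^'n"
  assumes S: "pos_def S"
  obtains k where "0 < k" "\<And>\<phi>. \<phi> \<in> borel_measurable borel \<Longrightarrow> power_fun S \<phi> \<mu> =
    k * (LINT x|lborel. \<phi> x * exp (- (x \<bullet> (matrix_inv S *v x)) / 2) * exp (x \<bullet> (matrix_inv S *v \<mu>)))"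
proof -
  let ?P = "matrix_inv S"
  let ?c = "1 / sqrt ((2 * pi) ^ CARD('n) * det S)"
  define k where "k = ?c * exp (- (\<mu> \<bullet> (?P *v \<mu>)) / 2)"
  have c: "0 < ?c"
    using pos_def_det_pos[OF S] by simp
  have q: "- ((x - \<mu>) \<bullet> (?P *v (x - \<mu>))) / 2
     = - (\<mu> \<bullet> (?P *v \<mu>)) / 2 + (- (x \<bullet> (?P *v x)) / 2 + x \<bullet> (?P *v \<mu>))" for x
    using pos_def_inner_commute[OF pos_def_matrix_inv[OF S], of \<mu> x]
    by (simp add: matrix_vector_mult_diff_distrib inner_diff_left inner_diff_right field_simps)
  have dens: "mvnormal_density \<mu> S x = k * (exp (- (x \<bullet> (?P *v x)) / 2) * exp (x \<bullet> (?P *v \<mu>)))" for x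
    unfolding mvnormal_density_def q exp_add k_def by (simp add: mult_ac)
  show ?thesis
  proof (rule that[of k])
    show k: "0 < k" using c by (simp add: k_def)
    fix \<phi> :: "real^'n \<Rightarrow> real" assume [measurable]: "\<phi> \<in> borel_measurable borel"
    have "(\<lambda>x. mvnormal_density \<mu> S x) \<in> borel_measurable borel"
      unfolding dens by (intro borel_measurable_continuous_onI continuous_intros) simp
    moreover have "0 \<le> mvnormal_density \<mu> S x" for x
      using k by (simp add: dens)
    ultimately have "power_fun S \<phi> \<mu> = (LINT x|lborel. mvnormal_density \<mu> S x *\<^sub>R \<phi> x)"
      unfolding power_fun_def mvnormal_def by (intro integral_density) simp_all
    also have "\<dots> = (LINT x|lborel. k * (\<phi> x * exp (- (x \<bullet> (?P *v x)) / 2) * exp (x \<bullet> (?P *v \<mu>))))"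
      by (simp add: dens mult_ac)
    finally show "power_fun S \<phi> \<mu> =
        k * (LINT x|lborel. \<phi> x * exp (- (x \<bullet> (?P *v x)) / 2) * exp (x \<bullet> (?P *v \<mu>)))"
      by simp
  qed
qed

text \<open>Where \<open>\<phi>\<close> is 0 the function \<open>F\<close> is nonnegative, where
  \<open>\<phi>\<close> is 1 it is nonpositive, so the interval sections give exactly the sign
  pattern required of \<open>F\<close>. Nothing is demanded at the ends of an interval.\<close>

lemma admissible_if_sections_intervals:
  fixes S :: "real^('n::finite)^'n"
  assumes S: "pos_def S" and \<phi>: "is_test \<phi>"
    and sect: "\<And>x. \<exists>a b. a \<le> b \<and> (\<forall>r. a < r \<and> r < b \<longrightarrow> \<phi> (x + r *\<^sub>R column i S) = 0) \<and>
        (\<forall>r. r < a \<or> b < r \<longrightarrow> \<phi> (x + r *\<^sub>R column i S) = 1)"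
  shows "admissible_test S i \<phi>"
  unfolding admissible_test_def
proof (intro conjI notI)
  show "is_test \<phi>" by fact
  assume "\<exists>\<psi>. is_test \<psi> \<and> better_test S i \<psi> \<phi>"
  then obtain \<psi> where \<psi>: "is_test \<psi>" and better: "better_test S i \<psi> \<phi>" by blast
  have [measurable]: "\<phi> \<in> borel_measurable borel" "\<psi> \<in> borel_measurable borel"
    using \<phi> \<psi> by (auto simp: is_test_def)
  let ?P = "matrix_inv S" and ?g = "column i S"
  have SP: "S *v (?P *v x) = x" "?P *v (S *v x) = x" for x
    using pos_def_invertible[OF S] by (simp_all add: matrix_vector_mul_assoc)
  define E where "E x = exp (- (x \<bullet> (?P *v x)) / 2)" for x
  have E: "all_exp_integrable E"
    unfolding E_def[abs_def] by (rule all_exp_integrable_pos_def[OF pos_def_matrix_inv[OF S]])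
  have [measurable]: "E \<in> borel_measurable borel"
    using E by (rule all_exp_integrableD)
  have test_int: "integrable lborel (\<lambda>x. \<tau> x * E x * exp (x \<bullet> v))" if "is_test \<tau>" for \<tau> v
  proof -
    have [measurable]: "\<tau> \<in> borel_measurable borel"
      using that by (simp add: is_test_def)
    have "all_exp_integrable (\<lambda>x. \<tau> x * E x)"
      by (rule all_exp_integrable_bound[OF E])
         (use that in \<open>auto simp: is_test_def abs_mult mult_left_le_one_le\<close>)
    then show ?thesis
      by (rule all_exp_integrableD)
  qed
  define F where "F x = (\<psi> x - \<phi> x) * E x" for x
  define G where "G v = (LINT x|lborel. F x * exp (x \<bullet> v))" for v
  have F: "all_exp_integrable F"
  proof (rule all_exp_integrable_bound[OF E])
    have "\<bar>\<psi> x - \<phi> x\<bar> \<le> 1" for x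
    proof -
      have "0 \<le> \<phi> x" "\<phi> x \<le> 1" "0 \<le> \<psi> x" "\<psi> x \<le> 1"
        using \<phi> \<psi> by (auto simp: is_test_def)
      then show ?thesis by linarith
    qed
    then show "\<bar>F x\<bar> \<le> \<bar>E x\<bar>" for x
      by (simp add: F_def abs_mult mult_left_le_one_le)
  qed (simp add: F_def[abs_def])
  have power: "\<exists>k>0. power_fun S \<psi> (S *v v) - power_fun S \<phi> (S *v v) = k * G v" for v
  proof -
    obtain k where "0 < k" and k': "\<And>\<tau>. \<tau> \<in> borel_measurable borel \<Longrightarrow> power_fun S \<tau> (S *v v) =
        k * (LINT x|lborel. \<tau> x * exp (- (x \<bullet> (?P *v x)) / 2) * exp (x \<bullet> (?P *v (S *v v))))"
      by (rule power_fun_eq_laplace[OF S, of "S *v v"]) blast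
    have k: "power_fun S \<tau> (S *v v) = k * (LINT x|lborel. \<tau> x * E x * exp (x \<bullet> v))"
      if "\<tau> \<in> borel_measurable borel" for \<tau>
      using k'[OF that] by (simp add: SP E_def)
    have "G v = (LINT x|lborel. \<psi> x * E x * exp (x \<bullet> v) - \<phi> x * E x * exp (x \<bullet> v))"
      unfolding G_def F_def by (simp add: algebra_simps)
    also have "\<dots> = (LINT x|lborel. \<psi> x * E x * exp (x \<bullet> v)) - (LINT x|lborel. \<phi> x * E x * exp (x \<bullet> v))"
      by (intro Bochner_Integration.integral_diff test_int \<phi> \<psi>)
    finally have "power_fun S \<psi> (S *v v) - power_fun S \<phi> (S *v v) = k * G v"
      by (simp add: k right_diff_distrib)
    with \<open>0 < k\<close> show ?thesis by blast
  qed
  have g: "?g = S *v axis i 1"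
    by (simp add: matrix_vector_mult_basis)
  have coord: "(S *v v) $ i = ?g \<bullet> v" for v
    using pos_def_inner_commute[OF S, of v "axis i 1"]
    by (simp add: g inner_commute[of _ v] inner_axis')
  have "AE x in lborel. F x = 0"
  proof (rule laplace_sign_imp_AE_zero[OF _ F])
    \<comment> \<open>The vector \<open>p\<close> is the \<open>i\<close>-th column of the inverse;
      it corresponds to the mean vector \<open>axis i 1\<close>.\<close>
    show "?g \<bullet> (?P *v axis i 1) = 1"
      using coord[of "?P *v axis i 1"] by (simp add: SP)
    show "(LINT x|lborel. F x * exp (x \<bullet> v)) \<le> 0" if "?g \<bullet> v = 0" for v
    proof -
      obtain k where "0 < k" and k: "power_fun S \<psi> (S *v v) - power_fun S \<phi> (S *v v) = k * G v"
        using power by blast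
      have "k * G v \<le> 0"
        unfolding k[symmetric] using better that by (simp add: better_test_def coord)
      then show ?thesis
        using \<open>0 < k\<close> by (simp add: G_def mult_le_0_iff)
    qed
    show "0 \<le> (LINT x|lborel. F x * exp (x \<bullet> v))" if "?g \<bullet> v \<noteq> 0" for v
    proof -
      obtain k where "0 < k" and k: "power_fun S \<psi> (S *v v) - power_fun S \<phi> (S *v v) = k * G v"
        using power by blast
      have "0 \<le> k * G v"
        unfolding k[symmetric] using better that by (simp add: better_test_def coord)
      then show ?thesis
        using \<open>0 < k\<close> by (simp add: G_def zero_le_mult_iff)
    qed
    have "F y \<ge> 0" if "\<phi> y = 0" for y
      using that \<psi> by (simp add: F_def E_def is_test_def)
    moreover have "F y \<le> 0" if "\<phi> y = 1" for y
      using that \<psi> by (simp add: F_def E_def is_test_def mult_nonpos_nonneg)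
    ultimately show "\<exists>a b. a \<le> b \<and> (\<forall>r. a < r \<and> r < b \<longrightarrow> 0 \<le> F (x + r *\<^sub>R ?g)) \<and>
        (\<forall>r. r < a \<or> b < r \<longrightarrow> F (x + r *\<^sub>R ?g) \<le> 0)" for x
      using sect[of x] by meson
  qed
  \<comment> \<open>With \<open>F\<close> null all transforms vanish, so both tests have the same
    power everywhere, against the strict inequality in \<open>better_test\<close>.\<close>
  then have "AE x in lborel. F x * exp (x \<bullet> v) = 0" for v
    by eventually_elim simp
  then have "G v = 0" for v
    unfolding G_def by (rule integral_eq_zero_AE)
  then have "power_fun S \<psi> \<mu> = power_fun S \<phi> \<mu>" for \<mu>
    using power[of "?P *v \<mu>"] by (auto simp: SP)
  then show False
    using better by (simp add: better_test_def)
qed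

theorem theorem3p1:
  fixes \<Sigma> :: "real^('n::{finite,linorder})^('n::{finite,linorder})"
    and C :: "nat \<Rightarrow> real"
  assumes "2 \<le> CARD('n)"
    and "pos_def \<Sigma>"
    and "\<exists>i j. i \<noteq> j \<and> \<Sigma> $ i $ j \<noteq> 0"
    and "\<And>m. 1 \<le> m \<Longrightarrow> m < CARD('n) \<Longrightarrow> C (Suc m) < C m"
    and "0 < C CARD('n)"
  shows "\<forall>i. admissible_test \<Sigma> i (mrd_test \<Sigma> C i)"
proof
  fix i
  show "admissible_test \<Sigma> i (mrd_test \<Sigma> C i)"
  proof (rule admissible_if_sections_intervals[OF assms(2) is_test_mrd_test])
    fix x
    obtain a b where "a \<le> b"
      "\<And>r. a < r \<Longrightarrow> r < b \<Longrightarrow> \<not> mrd_rejects \<Sigma> C (x + r *\<^sub>R column i \<Sigma>) i"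
      "\<And>r. r < a \<or> b < r \<Longrightarrow> mrd_rejects \<Sigma> C (x + r *\<^sub>R column i \<Sigma>) i"
      using mrd_section_interval[OF assms(2)] by blast
    then show "\<exists>a b. a \<le> b \<and> (\<forall>r. a < r \<and> r < b \<longrightarrow> mrd_test \<Sigma> C i (x + r *\<^sub>R column i \<Sigma>) = 0) \<and>
        (\<forall>r. r < a \<or> b < r \<longrightarrow> mrd_test \<Sigma> C i (x + r *\<^sub>R column i \<Sigma>) = 1)"
      by (intro exI[of _ a] exI[of _ b]) (simp add: mrd_test_def)
  qed
qed

end
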